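(* Let $\mathcal{C}$ be a category and let $d\geq2$. Let $C_d=\{e,g,\dots,g^{d-1}\}$ be the cyclic group of order $d$. There is a bijection between the sets of isomorphism classes $$\{\text{compatible pairs of order }d\text{ on }\mathcal{C}\}/{\simeq}\;\longleftrightarrow\;\{C_d\text{-actions on }\mathcal{C}\}/{\simeq},$$ sending a compatible pair to its induced $C_d$-action.
   Context: A $G$-action on $\mathcal{C}$ consists of autoequivalences $F_g$ ($g\in G$) and natural isomorphisms $\varepsilon_{g,h}\colon F_gF_h\to F_{gh}$ with $\varepsilon_{gh,l}\circ\varepsilon_{g,h}F_l=\varepsilon_{g,hl}\circ F_g\varepsilon_{h,l}$ for all $g,h,l\in G$. Two $G$-actions $\{F_g,\varepsilon_{g,h}\}$ and $\{F'_g,\varepsilon'_{g,h}\}$ on $\mathcal{C}$ are isomorphic if there are natural isomorphisms $\delta_g\colon F_g\to F'_g$ with $\delta_{gh}\circ\varepsilon_{g,h}=\varepsilon'_{g,h}\circ(F'_g\delta_h\circ\delta_gF_h)$ for all $g,h$. A compatible pair $(F,c)$ of order $d$ consists of an endofunctor $F$ on $\mathcal{C}$ and a natural isomorphism $c\colon F^d\to{\rm Id}_\mathcal{C}$ satisfying $Fc=cF$. Two compatible pairs $(F,c)$ and $(F',c')$ are isomorphic if there is a natural isomorphism $a\colon F\to F'$ with $c=c'\circ a^d$, where $a^i\colon F^i\to F'^i$ is defined by $a^1=a$ and $a^{i+1}=aF'^i\circ Fa^i$. The $C_d$-action induced from $(F,c)$ is $\{\bar F_{g^i},\bar\varepsilon_{g^i,g^j}\mid0\leq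 i,j\leq d-1\}$ with $\bar F_{g^i}=F^i$ ($F^0={\rm Id}_\mathcal{C}$), and $\bar\varepsilon_{g^i,g^j}\colon F^iF^j\to\bar F_{g^ig^j}$ equal to the identity if $i+j<d$ and to $F^{i+j-d}c$ if $i+j\geq d$. *)

theory Defs
  imports "HOL-Algebra.Coset"
begin

section \<open>Categories\<close>

record ('o, 'm) cat =
  Obj :: "'o set"
  Mor :: "'m set"
  Dom :: "'m \<Rightarrow> 'o"
  Cod :: "'m \<Rightarrow> 'o"
  Ident :: "'o \<Rightarrow> 'm"
  Comp :: "'m \<Rightarrow> 'm \<Rightarrow> 'm"

definition Hom :: "('o, 'm) cat \<Rightarrow> 'o \<Rightarrow> 'o \<Rightarrow> 'm set" where
  "Hom C x y = {f \<in> Mor C. Dom C f = x \<and> Cod C f = y}"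

text \<open>\<^term>\<open>Comp C g f\<close> is the composite of \<^term>\<open>f\<close> followed by \<^term>\<open>g\<close>; it is
  only constrained when \<^term>\<open>Cod C f = Dom C g\<close>.\<close>

locale category =
  fixes C :: "('o, 'm) cat"
  assumes dom_closed: "f \<in> Mor C \<Longrightarrow> Dom C f \<in> Obj C"
    and cod_closed: "f \<in> Mor C \<Longrightarrow> Cod C f \<in> Obj C"
    and ident_closed: "x \<in> Obj C \<Longrightarrow> Ident C x \<in> Hom C x x"
    and comp_closed: "\<lbrakk>f \<in> Hom C x y; g \<in> Hom C y z\<rbrakk> \<Longrightarrow> Comp C g f \<in> Hom C x z"
    and comp_ident_left: "f \<in> Hom C x y \<Longrightarrow> Comp C (Ident C y) f = f"
    and comp_ident_right: "f \<in> Hom C x y \<Longrightarrow> Comp C f (Ident C x) = f"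
    and comp_assoc: "\<lbrakk>f \<in> Hom C w x; g \<in> Hom C x y; h \<in> Hom C y z\<rbrakk> \<Longrightarrow>
      Comp C h (Comp C g f) = Comp C (Comp C h g) f"

definition iso_mor :: "('o, 'm) cat \<Rightarrow> 'm \<Rightarrow> bool" where
  "iso_mor C f \<longleftrightarrow> f \<in> Mor C \<and>
    (\<exists>g \<in> Hom C (Cod C f) (Dom C f).
      Comp C g f = Ident C (Dom C f) \<and> Comp C f g = Ident C (Cod C f))"

section \<open>Endofunctors and natural transformations\<close>

text \<open>Functors and natural transformations are extensional (undefined outside the
  objects and morphisms of the category), so that equality in HOL is the mathematical
  equality of functors and of natural transformations.\<close>

record ('o, 'm) func =
  omap :: "'o \<Rightarrow> 'o"
  mmap :: "'m \<Rightarrow> 'm"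

definition endofunctor :: "('o, 'm) cat \<Rightarrow> ('o, 'm) func \<Rightarrow> bool" where
  "endofunctor C F \<longleftrightarrow>
    omap F \<in> Obj C \<rightarrow>\<^sub>E Obj C \<and>
    mmap F \<in> Mor C \<rightarrow>\<^sub>E Mor C \<and>
    (\<forall>f \<in> Mor C. mmap F f \<in> Hom C (omap F (Dom C f)) (omap F (Cod C f))) \<and>
    (\<forall>x \<in> Obj C. mmap F (Ident C x) = Ident C (omap F x)) \<and>
    (\<forall>f \<in> Mor C. \<forall>g \<in> Mor C. Cod C f = Dom C g \<longrightarrow>
      mmap F (Comp C g f) = Comp C (mmap F g) (mmap F f))"

definition id_func :: "('o, 'm) cat \<Rightarrow> ('o, 'm) func" where
  "id_func C = \<lparr>omap = (\<lambda>x\<in>Obj C. x), mmap = (\<lambda>f\<in>Mor C. f)\<rparr>"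

definition comp_func :: "('o, 'm) cat \<Rightarrow> ('o, 'm) func \<Rightarrow> ('o, 'm) func \<Rightarrow> ('o, 'm) func" where
  "comp_func C F G =
    \<lparr>omap = compose (Obj C) (omap F) (omap G), mmap = compose (Mor C) (mmap F) (mmap G)\<rparr>"

primrec func_power :: "('o, 'm) cat \<Rightarrow> ('o, 'm) func \<Rightarrow> nat \<Rightarrow> ('o, 'm) func" where
  "func_power C F 0 = id_func C"
| "func_power C F (Suc i) = comp_func C F (func_power C F i)"

definition nat_trans ::
  "('o, 'm) cat \<Rightarrow> ('o, 'm) func \<Rightarrow> ('o, 'm) func \<Rightarrow> ('o \<Rightarrow> 'm) \<Rightarrow> bool" where
  "nat_trans C F G \<eta> \<longleftrightarrow>
    \<eta> \<in> (\<Pi>\<^sub>E x\<in>Obj C. Hom C (omap F x) (omap G x)) \<and>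
    (\<forall>f \<in> Mor C. Comp C (\<eta> (Cod C f)) (mmap F f) = Comp C (mmap G f) (\<eta> (Dom C f)))"

definition nat_iso ::
  "('o, 'm) cat \<Rightarrow> ('o, 'm) func \<Rightarrow> ('o, 'm) func \<Rightarrow> ('o \<Rightarrow> 'm) \<Rightarrow> bool" where
  "nat_iso C F G \<eta> \<longleftrightarrow> nat_trans C F G \<eta> \<and> (\<forall>x \<in> Obj C. iso_mor C (\<eta> x))"

definition id_nt :: "('o, 'm) cat \<Rightarrow> ('o, 'm) func \<Rightarrow> 'o \<Rightarrow> 'm" where
  "id_nt C F = (\<lambda>x\<in>Obj C. Ident C (omap F x))"

definition comp_nt :: "('o, 'm) cat \<Rightarrow> ('o \<Rightarrow> 'm) \<Rightarrow> ('o \<Rightarrow> 'm) \<Rightarrow> 'o \<Rightarrow> 'm" where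
  "comp_nt C \<theta> \<eta> = (\<lambda>x\<in>Obj C. Comp C (\<theta> x) (\<eta> x))"

text \<open>The whiskerings \<open>F\<eta>\<close> and \<open>\<eta>F\<close>.\<close>

definition whisker_left :: "('o, 'm) cat \<Rightarrow> ('o, 'm) func \<Rightarrow> ('o \<Rightarrow> 'm) \<Rightarrow> 'o \<Rightarrow> 'm" where
  "whisker_left C F \<eta> = (\<lambda>x\<in>Obj C. mmap F (\<eta> x))"

definition whisker_right :: "('o, 'm) cat \<Rightarrow> ('o \<Rightarrow> 'm) \<Rightarrow> ('o, 'm) func \<Rightarrow> 'o \<Rightarrow> 'm" where
  "whisker_right C \<eta> F = (\<lambda>x\<in>Obj C. \<eta> (omap F x))"

definition autoequivalence :: "('o, 'm) cat \<Rightarrow> ('o, 'm) func \<Rightarrow> bool" where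
  "autoequivalence C F \<longleftrightarrow> endofunctor C F \<and>
    (\<exists>G \<eta> \<theta>. endofunctor C G \<and>
      nat_iso C (comp_func C F G) (id_func C) \<eta> \<and>
      nat_iso C (comp_func C G F) (id_func C) \<theta>)"

section \<open>Compatible pairs\<close>

definition compatible_pairs :: "('o, 'm) cat \<Rightarrow> nat \<Rightarrow> (('o, 'm) func \<times> ('o \<Rightarrow> 'm)) set" where
  "compatible_pairs C d = {(F, c). endofunctor C F \<and>
    nat_iso C (func_power C F d) (id_func C) c \<and>
    whisker_left C F c = whisker_right C c F}"

text \<open>The power \<open>a\<^sup>i : F\<^sup>i \<rightarrow> F'\<^sup>i\<close> of \<open>a : F \<rightarrow> F'\<close>.  Mathematically the recursion
  starts at \<open>i = 1\<close>; the value at \<open>0\<close> is the identity of the identity functor.\<close>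

fun nt_power :: "('o, 'm) cat \<Rightarrow> ('o, 'm) func \<Rightarrow> ('o, 'm) func \<Rightarrow> ('o \<Rightarrow> 'm) \<Rightarrow> nat \<Rightarrow> 'o \<Rightarrow> 'm"
where
  "nt_power C F F' a 0 = id_nt C (id_func C)"
| "nt_power C F F' a (Suc 0) = a"
| "nt_power C F F' a (Suc (Suc i)) =
    comp_nt C (whisker_right C a (func_power C F' (Suc i)))
      (whisker_left C F (nt_power C F F' a (Suc i)))"

definition pair_iso ::
  "('o, 'm) cat \<Rightarrow> nat \<Rightarrow>
   ((('o, 'm) func \<times> ('o \<Rightarrow> 'm)) \<times> (('o, 'm) func \<times> ('o \<Rightarrow> 'm))) set" where
  "pair_iso C d = {((F, c), (F', c')).
    (F, c) \<in> compatible_pairs C d \<and> (F', c') \<in> compatible_pairs C d \<and>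
    (\<exists>a. nat_iso C F F' a \<and> c = comp_nt C c' (nt_power C F F' a d))}"

section \<open>Group actions on a category\<close>

text \<open>An action is a pair \<open>(F, \<epsilon>)\<close> of families indexed by the carrier of the group;
  both families are extensional.\<close>

definition group_actions ::
  "('o, 'm) cat \<Rightarrow> ('g, 'r) monoid_scheme \<Rightarrow>
   (('g \<Rightarrow> ('o, 'm) func) \<times> ('g \<times> 'g \<Rightarrow> 'o \<Rightarrow> 'm)) set" where
  "group_actions C G = {(F, \<epsilon>).
    F \<in> carrier G \<rightarrow>\<^sub>E {H. autoequivalence C H} \<and>
    \<epsilon> \<in> (\<Pi>\<^sub>E (g, h) \<in> carrier G \<times> carrier G.
            {\<eta>. nat_iso C (comp_func C (F g) (F h)) (F (g \<otimes>\<^bsub>G\<^esub> h)) \<eta>}) \<and>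
    (\<forall>g \<in> carrier G. \<forall>h \<in> carrier G. \<forall>l \<in> carrier G.
      comp_nt C (\<epsilon> (g \<otimes>\<^bsub>G\<^esub> h, l)) (whisker_right C (\<epsilon> (g, h)) (F l)) =
      comp_nt C (\<epsilon> (g, h \<otimes>\<^bsub>G\<^esub> l)) (whisker_left C (F g) (\<epsilon> (h, l))))}"

definition action_iso ::
  "('o, 'm) cat \<Rightarrow> ('g, 'r) monoid_scheme \<Rightarrow>
   ((('g \<Rightarrow> ('o, 'm) func) \<times> ('g \<times> 'g \<Rightarrow> 'o \<Rightarrow> 'm)) \<times>
    (('g \<Rightarrow> ('o, 'm) func) \<times> ('g \<times> 'g \<Rightarrow> 'o \<Rightarrow> 'm))) set" where
  "action_iso C G = {((F, \<epsilon>), (F', \<epsilon>')).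
    (F, \<epsilon>) \<in> group_actions C G \<and> (F', \<epsilon>') \<in> group_actions C G \<and>
    (\<exists>\<delta>. (\<forall>g \<in> carrier G. nat_iso C (F g) (F' g) (\<delta> g)) \<and>
      (\<forall>g \<in> carrier G. \<forall>h \<in> carrier G.
        comp_nt C (\<delta> (g \<otimes>\<^bsub>G\<^esub> h)) (\<epsilon> (g, h)) =
        comp_nt C (\<epsilon>' (g, h))
          (comp_nt C (whisker_left C (F' g) (\<delta> h)) (whisker_right C (\<delta> g) (F h)))))}"

section \<open>The induced action\<close>

text \<open>The exponent \<open>i < d\<close> with \<open>h = g\<^sup>i\<close>, where \<open>g\<close> generates the cyclic group \<open>G\<close> of
  order \<open>d\<close>.\<close>

definition exponent :: "('g, 'r) monoid_scheme \<Rightarrow> 'g \<Rightarrow> nat \<Rightarrow> 'g \<Rightarrow> nat" where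
  "exponent G g d h = (THE i. i < d \<and> h = g [^]\<^bsub>G\<^esub> i)"

definition induced_action ::
  "('o, 'm) cat \<Rightarrow> ('g, 'r) monoid_scheme \<Rightarrow> 'g \<Rightarrow> nat \<Rightarrow> ('o, 'm) func \<times> ('o \<Rightarrow> 'm) \<Rightarrow>
   ('g \<Rightarrow> ('o, 'm) func) \<times> ('g \<times> 'g \<Rightarrow> 'o \<Rightarrow> 'm)" where
  "induced_action C G g d = (\<lambda>(F, c).
    ((\<lambda>h\<in>carrier G. func_power C F (exponent G g d h)),
     (\<lambda>(h, k)\<in>carrier G \<times> carrier G.
        let i = exponent G g d h; j = exponent G g d k
        in if i + j < d then id_nt C (func_power C F (i + j))
           else whisker_left C (func_power C F (i + j - d)) c)))"

end

theory Submission
  imports Defs "HOL-Algebra.Multiplicative_Group"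
begin

text \<open>An action of the cyclic group assigns to \<open>g\<^sup>i\<close> a functor isomorphic to \<open>F\<^sup>i\<close>, where
  \<open>F\<close> is the functor at the generator. The only further datum is how the relation
  \<open>g\<^sup>d = 1\<close> acts, that is, an isomorphism \<open>c : F\<^sup>d \<rightarrow> Id\<close>; associativity for the element
  \<open>g\<^bsup>d + 1\<^esup>\<close>, read as \<open>g g\<^sup>d\<close> and as \<open>g\<^sup>d g\<close>, is the compatibility \<open>F c = c F\<close>.

  The induced action is controlled by the isomorphisms \<open>r\<^sub>n : F\<^sup>n \<rightarrow> F\<^bsup>n mod d\<^esup>\<close>
  (\<open>reduce\<close>) that cancel blocks of \<open>d\<close> factors by \<open>c\<close>: its structure
  isomorphism at \<open>(g\<^sup>i, g\<^sup>j)\<close> is \<open>r\<^bsub>i + j\<^esub>\<close>. Both sides of the cocycle condition reduce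
  \<open>F\<^sup>i F\<^sup>j F\<^sup>l\<close>, after reducing either the left or the right pair of factors, and both equal
  \<open>r\<^bsub>i + j + l\<^esub>\<close> (\<open>reduce_add_left\<close>, \<open>reduce_add_right\<close>).

  For injectivity, an isomorphism \<open>a\<close> of pairs gives the isomorphism \<open>g\<^sup>i \<mapsto> a\<^sup>i\<close> of induced
  actions, and multiplicativity forces every isomorphism \<open>\<delta>\<close> of induced actions to be of this
  form with \<open>a = \<delta>\<^sub>g\<close>. So two pairs are isomorphic exactly when their induced actions are.

  For surjectivity, let \<open>(E, \<epsilon>)\<close> be an action. Its value at the unit is an equivalence, so it
  has a unit isomorphism \<open>u : E\<^sub>1 \<rightarrow> Id\<close> satisfying the unit laws (\<open>group_action_unit\<close>,
  \<open>unit_left\<close>, \<open>unit_right\<close>). Iterating \<open>\<epsilon>\<close> from \<open>u\<^sup>-\<^sup>1\<close> gives multiplicative isomorphisms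
  \<open>E\<^sub>g\<^sup>n \<rightarrow> E\<^bsub>g^n\<^esub>\<close> for all \<open>n\<close> (\<open>collect_add\<close>). For \<open>n = d\<close>, followed by \<open>u\<close>, this is the
  isomorphism \<open>c : E\<^sub>g\<^sup>d \<rightarrow> Id\<close> of a compatible pair; for \<open>n < d\<close> these isomorphisms compare the
  action induced from \<open>(E\<^sub>g, c)\<close> with the given one.\<close>

section \<open>Calculus of categories, functors and natural transformations\<close>

lemma Hom_iff: "f \<in> Hom C x y \<longleftrightarrow> f \<in> Mor C \<and> Dom C f = x \<and> Cod C f = y"
  by (simp add: Hom_def)

context category
begin

abbreviation comp_infix (infixr "\<cdot>" 70) where "h \<cdot> f \<equiv> Comp C h f"

lemma Obj_Dom_Cod [simp]:
  "f \<in> Mor C \<Longrightarrow> Dom C f \<in> Obj C"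
  "f \<in> Mor C \<Longrightarrow> Cod C f \<in> Obj C"
  by (rule dom_closed cod_closed, assumption)+

lemma Ident_typing [simp]:
  assumes "x \<in> Obj C"
  shows "Ident C x \<in> Mor C" "Dom C (Ident C x) = x" "Cod C (Ident C x) = x"
  using ident_closed[OF assms] by (simp_all add: Hom_iff)

lemma Comp_typing [simp]:
  assumes "f \<in> Mor C" "h \<in> Mor C" "Cod C f = Dom C h"
  shows "h \<cdot> f \<in> Mor C" "Dom C (h \<cdot> f) = Dom C f" "Cod C (h \<cdot> f) = Cod C h"
  using comp_closed[of f "Dom C f" "Cod C f" h "Cod C h"] assms by (simp_all add: Hom_iff)

lemma Comp_assoc [simp]:
  assumes "f \<in> Mor C" "h \<in> Mor C" "k \<in> Mor C" "Cod C f = Dom C h" "Cod C h = Dom C k"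
  shows "(k \<cdot> h) \<cdot> f = k \<cdot> h \<cdot> f"
  using comp_assoc[of f "Dom C f" "Cod C f" h "Cod C h" k "Cod C k"] assms
  by (simp add: Hom_iff)

lemma Comp_Ident [simp]:
  "\<lbrakk>f \<in> Mor C; Cod C f = y\<rbrakk> \<Longrightarrow> Ident C y \<cdot> f = f"
  "\<lbrakk>f \<in> Mor C; Dom C f = x\<rbrakk> \<Longrightarrow> f \<cdot> Ident C x = f"
  using comp_ident_left comp_ident_right by (auto simp: Hom_iff)

lemma endofunctor_typing [simp]:
  assumes "endofunctor C F"
  shows "x \<in> Obj C \<Longrightarrow> omap F x \<in> Obj C"
    and "f \<in> Mor C \<Longrightarrow> mmap F f \<in> Mor C"
    and "f \<in> Mor C \<Longrightarrow> Dom C (mmap F f) = omap F (Dom C f)"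
    and "f \<in> Mor C \<Longrightarrow> Cod C (mmap F f) = omap F (Cod C f)"
  using assms by (auto simp: endofunctor_def Hom_iff)

lemma endofunctor_Ident [simp]:
  "\<lbrakk>endofunctor C F; x \<in> Obj C\<rbrakk> \<Longrightarrow> mmap F (Ident C x) = Ident C (omap F x)"
  by (simp add: endofunctor_def)

lemma endofunctor_Comp:
  "\<lbrakk>endofunctor C F; f \<in> Mor C; h \<in> Mor C; Cod C f = Dom C h\<rbrakk> \<Longrightarrow>
    mmap F (h \<cdot> f) = mmap F h \<cdot> mmap F f"
  by (simp add: endofunctor_def)

lemma endofunctor_eqI:
  assumes "endofunctor C F" "endofunctor C H"
    and "\<And>x. x \<in> Obj C \<Longrightarrow> omap F x = omap H x"
    and "\<And>f. f \<in> Mor C \<Longrightarrow> mmap F f = mmap H f"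
  shows "F = H"
proof -
  have "omap F = omap H"
    using assms by (intro PiE_ext[of _ "Obj C" "\<lambda>_. Obj C"]) (auto simp: endofunctor_def)
  moreover have "mmap F = mmap H"
    using assms by (intro PiE_ext[of _ "Mor C" "\<lambda>_. Mor C"]) (auto simp: endofunctor_def)
  ultimately show ?thesis
    by simp
qed

lemma id_func_simps [simp]:
  "x \<in> Obj C \<Longrightarrow> omap (id_func C) x = x"
  "f \<in> Mor C \<Longrightarrow> mmap (id_func C) f = f"
  by (simp_all add: id_func_def)

lemma comp_func_simps [simp]:
  "x \<in> Obj C \<Longrightarrow> omap (comp_func C F H) x = omap F (omap H x)"
  "f \<in> Mor C \<Longrightarrow> mmap (comp_func C F H) f = mmap F (mmap H f)"
  by (simp_all add: comp_func_def compose_def)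

lemma endofunctor_id_func [simp]: "endofunctor C (id_func C)"
  by (auto simp: endofunctor_def Hom_iff id_func_def)

lemma endofunctor_comp_func [simp]:
  "\<lbrakk>endofunctor C F; endofunctor C H\<rbrakk> \<Longrightarrow> endofunctor C (comp_func C F H)"
  unfolding endofunctor_def[of C "comp_func C F H"]
  by (auto simp: Hom_iff endofunctor_Comp) (simp_all add: comp_func_def compose_def)

lemma endofunctor_func_power [simp]:
  "endofunctor C F \<Longrightarrow> endofunctor C (func_power C F n)"
  by (induction n) simp_all

lemma comp_func_id_func [simp]:
  assumes "endofunctor C F"
  shows "comp_func C F (id_func C) = F" "comp_func C (id_func C) F = F"
  using assms by (auto intro!: endofunctor_eqI)

lemma comp_func_assoc:
  assumes "endofunctor C F" "endofunctor C H" "endofunctor C K"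
  shows "comp_func C (comp_func C F H) K = comp_func C F (comp_func C H K)"
  using assms by (auto intro!: endofunctor_eqI)

lemma func_power_add:
  "endofunctor C F \<Longrightarrow>
    func_power C F (m + n) = comp_func C (func_power C F m) (func_power C F n)"
  by (induction m) (simp_all add: comp_func_assoc)

lemma func_power_add_simps:
  assumes "endofunctor C F"
  shows "x \<in> Obj C \<Longrightarrow>
      omap (func_power C F m) (omap (func_power C F n) x) = omap (func_power C F (m + n)) x"
    and "f \<in> Mor C \<Longrightarrow>
      mmap (func_power C F m) (mmap (func_power C F n) f) = mmap (func_power C F (m + n)) f"
  using assms by (simp_all add: func_power_add)

text \<open>Transformations enter computations through their components, so that all equations
  between them become equations between composable morphisms.\<close>

lemma nat_trans_typing:
  assumes "nat_trans C F H \<eta>"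
  shows "x \<in> Obj C \<Longrightarrow> \<eta> x \<in> Mor C"
    and "x \<in> Obj C \<Longrightarrow> Dom C (\<eta> x) = omap F x"
    and "x \<in> Obj C \<Longrightarrow> Cod C (\<eta> x) = omap H x"
  using assms by (auto simp: nat_trans_def Hom_iff dest!: PiE_mem)

lemma naturality:
  "\<lbrakk>nat_trans C F H \<eta>; f \<in> Mor C; Dom C f = x; Cod C f = y\<rbrakk> \<Longrightarrow>
    \<eta> y \<cdot> mmap F f = mmap H f \<cdot> \<eta> x"
  by (auto simp: nat_trans_def)

lemma nat_transI:
  assumes "\<eta> \<in> extensional (Obj C)"
    and "\<And>x. x \<in> Obj C \<Longrightarrow> \<eta> x \<in> Mor C \<and> Dom C (\<eta> x) = omap F x \<and> Cod C (\<eta> x) = omap H x"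
    and "\<And>f. f \<in> Mor C \<Longrightarrow> \<eta> (Cod C f) \<cdot> mmap F f = mmap H f \<cdot> \<eta> (Dom C f)"
  shows "nat_trans C F H \<eta>"
  using assms by (auto simp: nat_trans_def Hom_iff PiE_def)

lemma nat_trans_eqI:
  assumes "nat_trans C F H \<eta>" "nat_trans C F' H' \<theta>" "\<And>x. x \<in> Obj C \<Longrightarrow> \<eta> x = \<theta> x"
  shows "\<eta> = \<theta>"
  using assms by (intro extensionalityI[of _ "Obj C"]) (auto simp: nat_trans_def PiE_def)

lemma nat_iso_trans: "nat_iso C F H \<eta> \<Longrightarrow> nat_trans C F H \<eta>"
  by (simp add: nat_iso_def)

lemmas nat_iso_typing = nat_trans_typing[OF nat_iso_trans]

lemma nat_iso_iso_mor: "\<lbrakk>nat_iso C F H \<eta>; x \<in> Obj C\<rbrakk> \<Longrightarrow> iso_mor C (\<eta> x)"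
  by (simp add: nat_iso_def)

lemma iso_morI:
  assumes "f \<in> Mor C" "k \<in> Mor C" "Dom C k = Cod C f" "Cod C k = Dom C f"
    "k \<cdot> f = Ident C (Dom C f)" "f \<cdot> k = Ident C (Cod C f)"
  shows "iso_mor C f"
  using assms by (auto simp: iso_mor_def Hom_iff)

lemma iso_morE:
  assumes "iso_mor C f"
  obtains k where "f \<in> Mor C" "k \<in> Mor C" "Dom C k = Cod C f" "Cod C k = Dom C f"
    "k \<cdot> f = Ident C (Dom C f)" "f \<cdot> k = Ident C (Cod C f)"
  using assms by (auto simp: iso_mor_def Hom_iff)

lemma iso_mor_cancel_left:
  assumes "iso_mor C k" "k \<cdot> f = k \<cdot> h" "f \<in> Mor C" "h \<in> Mor C"
    "Cod C f = Dom C k" "Cod C h = Dom C k"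
  shows "f = h"
proof -
  obtain l where l: "k \<in> Mor C" "l \<in> Mor C" "Dom C l = Cod C k" "l \<cdot> k = Ident C (Dom C k)"
    using assms(1) by (rule iso_morE)
  have "l \<cdot> k \<cdot> f = l \<cdot> k \<cdot> h"
    by (simp add: assms(2))
  then have "(l \<cdot> k) \<cdot> f = (l \<cdot> k) \<cdot> h"
    using assms(3-) l(1-3) by simp
  then show ?thesis
    using assms(3-) by (simp add: l(4))
qed

lemma iso_mor_cancel_right:
  assumes "iso_mor C k" "f \<cdot> k = h \<cdot> k" "f \<in> Mor C" "h \<in> Mor C"
    "Dom C f = Cod C k" "Dom C h = Cod C k"
  shows "f = h"
proof -
  obtain l where l: "k \<in> Mor C" "l \<in> Mor C" "Cod C l = Dom C k" "k \<cdot> l = Ident C (Cod C k)"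
    using assms(1) by (rule iso_morE)
  have "(f \<cdot> k) \<cdot> l = (h \<cdot> k) \<cdot> l"
    by (simp add: assms(2))
  then show ?thesis
    using assms(3-) l by simp
qed

lemma iso_mor_Ident [simp]: "x \<in> Obj C \<Longrightarrow> iso_mor C (Ident C x)"
  by (rule iso_morI[of _ "Ident C x"]) simp_all

lemma iso_mor_Comp:
  assumes "iso_mor C f" "iso_mor C h" "Cod C f = Dom C h"
  shows "iso_mor C (h \<cdot> f)"
proof -
  obtain k where k: "f \<in> Mor C" "k \<in> Mor C" "Dom C k = Cod C f" "Cod C k = Dom C f"
      "k \<cdot> f = Ident C (Dom C f)" "f \<cdot> k = Ident C (Cod C f)"
    using assms(1) by (rule iso_morE)
  obtain l where l: "h \<in> Mor C" "l \<in> Mor C" "Dom C l = Cod C h" "Cod C l = Dom C h"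
      "l \<cdot> h = Ident C (Dom C h)" "h \<cdot> l = Ident C (Cod C h)"
    using assms(2) by (rule iso_morE)
  have "l \<cdot> h \<cdot> f = (l \<cdot> h) \<cdot> f" "f \<cdot> k \<cdot> l = (f \<cdot> k) \<cdot> l"
    using k(1-4) l(1-4) assms(3) by simp_all
  then show ?thesis
    using k l assms(3) by (intro iso_morI[of _ "k \<cdot> l"]) simp_all
qed

lemma iso_mor_mmap:
  assumes "endofunctor C F" "iso_mor C f"
  shows "iso_mor C (mmap F f)"
proof -
  obtain k where k: "f \<in> Mor C" "k \<in> Mor C" "Dom C k = Cod C f" "Cod C k = Dom C f"
      "k \<cdot> f = Ident C (Dom C f)" "f \<cdot> k = Ident C (Cod C f)"
    using assms(2) by (rule iso_morE)
  show ?thesis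
    using k assms(1) endofunctor_Comp[OF assms(1), of k f] endofunctor_Comp[OF assms(1), of f k]
    by (intro iso_morI[of _ "mmap F k"]) simp_all
qed

lemma id_nt_apply [simp]: "x \<in> Obj C \<Longrightarrow> id_nt C F x = Ident C (omap F x)"
  by (simp add: id_nt_def)

lemma comp_nt_apply [simp]: "x \<in> Obj C \<Longrightarrow> comp_nt C \<theta> \<eta> x = \<theta> x \<cdot> \<eta> x"
  by (simp add: comp_nt_def)

lemma whisker_left_apply [simp]: "x \<in> Obj C \<Longrightarrow> whisker_left C F \<eta> x = mmap F (\<eta> x)"
  by (simp add: whisker_left_def)

lemma whisker_right_apply [simp]: "x \<in> Obj C \<Longrightarrow> whisker_right C \<eta> F x = \<eta> (omap F x)"
  by (simp add: whisker_right_def)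

lemma nat_iso_id_nt: "endofunctor C F \<Longrightarrow> nat_iso C F F (id_nt C F)"
  unfolding nat_iso_def by (auto intro!: nat_transI simp: id_nt_def)

lemma nat_iso_comp_nt:
  assumes "nat_iso C F H \<eta>" "nat_iso C H K \<theta>" "endofunctor C F" "endofunctor C H" "endofunctor C K"
  shows "nat_iso C F K (comp_nt C \<theta> \<eta>)"
  unfolding nat_iso_def
proof (intro conjI ballI nat_transI)
  note [simp] = nat_iso_typing[OF assms(1)] nat_iso_typing[OF assms(2)] assms(3-)
  show "comp_nt C \<theta> \<eta> \<in> extensional (Obj C)"
    by (simp add: comp_nt_def)
  fix x assume [simp]: "x \<in> Obj C"
  show "comp_nt C \<theta> \<eta> x \<in> Mor C" "Dom C (comp_nt C \<theta> \<eta> x) = omap F x"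
    "Cod C (comp_nt C \<theta> \<eta> x) = omap K x"
    by simp_all
  show "iso_mor C (comp_nt C \<theta> \<eta> x)"
    using assms by (simp add: iso_mor_Comp nat_iso_iso_mor)
next
  note [simp] = nat_iso_typing[OF assms(1)] nat_iso_typing[OF assms(2)] assms(3-)
  fix f assume [simp]: "f \<in> Mor C"
  have "(\<theta> (Cod C f) \<cdot> \<eta> (Cod C f)) \<cdot> mmap F f = \<theta> (Cod C f) \<cdot> mmap H f \<cdot> \<eta> (Dom C f)"
    using naturality[OF nat_iso_trans[OF assms(1)], of f] by simp
  also have "\<dots> = (\<theta> (Cod C f) \<cdot> mmap H f) \<cdot> \<eta> (Dom C f)"
    by (simp del: Comp_assoc add: Comp_assoc[symmetric])
  also have "\<dots> = mmap K f \<cdot> \<theta> (Dom C f) \<cdot> \<eta> (Dom C f)"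
    using naturality[OF nat_iso_trans[OF assms(2)], of f] by simp
  finally show "comp_nt C \<theta> \<eta> (Cod C f) \<cdot> mmap F f = mmap K f \<cdot> comp_nt C \<theta> \<eta> (Dom C f)"
    by simp
qed

lemma nat_iso_whisker_left:
  assumes "nat_iso C F H \<eta>" "endofunctor C K" "endofunctor C F" "endofunctor C H"
  shows "nat_iso C (comp_func C K F) (comp_func C K H) (whisker_left C K \<eta>)"
proof -
  note [simp] = nat_iso_typing[OF assms(1)] assms(2-)
  have "whisker_left C K \<eta> \<in> extensional (Obj C)"
    by (simp add: whisker_left_def)
  moreover have "mmap K (\<eta> (Cod C f)) \<cdot> mmap K (mmap F f) = mmap K (mmap H f) \<cdot> mmap K (\<eta> (Dom C f))"
    if [simp]: "f \<in> Mor C" for f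
    using naturality[OF nat_iso_trans[OF assms(1)], of f]
    by (simp flip: endofunctor_Comp)
  ultimately show ?thesis
    using assms unfolding nat_iso_def[of C "comp_func C K F"]
    by (auto intro!: nat_transI simp: iso_mor_mmap nat_iso_iso_mor)
qed

lemma nat_iso_whisker_right:
  assumes "nat_iso C F H \<eta>" "endofunctor C K" "endofunctor C F" "endofunctor C H"
  shows "nat_iso C (comp_func C F K) (comp_func C H K) (whisker_right C \<eta> K)"
proof -
  note [simp] = nat_iso_typing[OF assms(1)] assms(2-)
  have "whisker_right C \<eta> K \<in> extensional (Obj C)"
    by (simp add: whisker_right_def)
  then show ?thesis
    using assms unfolding nat_iso_def[of C "comp_func C F K"]
    by (auto intro!: nat_transI simp: naturality[OF nat_iso_trans[OF assms(1)]] nat_iso_iso_mor)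
qed

lemma nat_iso_inverse:
  assumes "nat_iso C F H \<eta>" "endofunctor C F" "endofunctor C H"
  obtains \<theta> where "nat_iso C H F \<theta>"
    "\<And>x. x \<in> Obj C \<Longrightarrow> \<theta> x \<cdot> \<eta> x = Ident C (omap F x)"
    "\<And>x. x \<in> Obj C \<Longrightarrow> \<eta> x \<cdot> \<theta> x = Ident C (omap H x)"
proof -
  note [simp] = nat_iso_typing[OF assms(1)] assms(2-)
  have "\<forall>x. \<exists>k. x \<in> Obj C \<longrightarrow> k \<in> Mor C \<and> Dom C k = omap H x \<and> Cod C k = omap F x \<and>
      k \<cdot> \<eta> x = Ident C (omap F x) \<and> \<eta> x \<cdot> k = Ident C (omap H x)"
  proof (intro allI)
    fix x
    show "\<exists>k. x \<in> Obj C \<longrightarrow> k \<in> Mor C \<and> Dom C k = omap H x \<and> Cod C k = omap F x \<and>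
      k \<cdot> \<eta> x = Ident C (omap F x) \<and> \<eta> x \<cdot> k = Ident C (omap H x)"
      using nat_iso_iso_mor[OF assms(1), of x] nat_iso_typing[OF assms(1), of x]
      by (metis iso_morE)
  qed
  then obtain k where k [simp]: "\<And>x. x \<in> Obj C \<Longrightarrow> k x \<in> Mor C"
      "\<And>x. x \<in> Obj C \<Longrightarrow> Dom C (k x) = omap H x" "\<And>x. x \<in> Obj C \<Longrightarrow> Cod C (k x) = omap F x"
      "\<And>x. x \<in> Obj C \<Longrightarrow> k x \<cdot> \<eta> x = Ident C (omap F x)"
      "\<And>x. x \<in> Obj C \<Longrightarrow> \<eta> x \<cdot> k x = Ident C (omap H x)"
    by metis
  have nat: "k (Cod C f) \<cdot> mmap H f = mmap F f \<cdot> k (Dom C f)" if [simp]: "f \<in> Mor C" for f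
  proof (rule iso_mor_cancel_left[OF nat_iso_iso_mor[OF assms(1)], of "Cod C f"])
    have "\<eta> (Cod C f) \<cdot> mmap F f \<cdot> k (Dom C f) = (\<eta> (Cod C f) \<cdot> mmap F f) \<cdot> k (Dom C f)"
      by simp
    also have "\<dots> = mmap H f"
      unfolding naturality[OF nat_iso_trans[OF assms(1)] that refl refl] by simp
    also have "\<dots> = (\<eta> (Cod C f) \<cdot> k (Cod C f)) \<cdot> mmap H f"
      by (simp del: Comp_assoc)
    also have "\<dots> = \<eta> (Cod C f) \<cdot> k (Cod C f) \<cdot> mmap H f"
      by (simp del: k(5))
    finally show "\<eta> (Cod C f) \<cdot> k (Cod C f) \<cdot> mmap H f = \<eta> (Cod C f) \<cdot> mmap F f \<cdot> k (Dom C f)" ..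
  qed simp_all
  have iso: "iso_mor C (k x)" if "x \<in> Obj C" for x
    using that by (intro iso_morI[of _ "\<eta> x"]) simp_all
  have "nat_iso C H F (restrict k (Obj C))"
    unfolding nat_iso_def using iso by (auto intro!: nat_transI simp: nat)
  then show ?thesis
    by (rule that) simp_all
qed

text \<open>A functor with a left quasi-inverse is faithful: a natural isomorphism
  \<open>\<eta> : B A \<rightarrow> Id\<close> recovers \<open>f\<close> from \<open>B (A f)\<close> as \<open>\<eta> \<circ> B (A f) \<circ> \<eta>\<^sup>-\<^sup>1\<close>.\<close>

lemma left_invertible_functor_faithful:
  assumes "nat_iso C (comp_func C B A) (id_func C) \<eta>" "endofunctor C A" "endofunctor C B"
    and "mmap A f = mmap A h" "f \<in> Mor C" "h \<in> Mor C" "Dom C f = Dom C h" "Cod C f = Cod C h"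
  shows "f = h"
proof (rule iso_mor_cancel_right[OF nat_iso_iso_mor[OF assms(1)], of "Dom C f"])
  note [simp] = nat_iso_typing[OF assms(1)] assms(2-)
  show "f \<cdot> \<eta> (Dom C f) = h \<cdot> \<eta> (Dom C f)"
    using naturality[OF nat_iso_trans[OF assms(1)], of f] naturality[OF nat_iso_trans[OF assms(1)], of h]
    by simp
qed (use assms nat_iso_typing[OF assms(1)] in simp_all)

section \<open>Horizontal composition\<close>

text \<open>The horizontal composite \<open>F H \<rightarrow> F' H'\<close> of \<open>a : F \<rightarrow> F'\<close> and \<open>b : H \<rightarrow> H'\<close>. An
  isomorphism \<open>\<delta>\<close> of actions is multiplicative with respect to \<open>\<delta>\<^sub>h * \<delta>\<^sub>k\<close>, so that the
  interchange law below lets such isomorphisms be composed and inverted.\<close>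

definition hcomp ::
  "('o, 'm) func \<Rightarrow> ('o, 'm) func \<Rightarrow> ('o \<Rightarrow> 'm) \<Rightarrow> ('o \<Rightarrow> 'm) \<Rightarrow> 'o \<Rightarrow> 'm" where
  "hcomp F' H a b = comp_nt C (whisker_left C F' b) (whisker_right C a H)"

lemma hcomp_apply [simp]: "x \<in> Obj C \<Longrightarrow> hcomp F' H a b x = mmap F' (b x) \<cdot> a (omap H x)"
  by (simp add: hcomp_def)

lemma nat_iso_hcomp:
  assumes "nat_iso C F F' a" "nat_iso C H H' b"
    "endofunctor C F" "endofunctor C F'" "endofunctor C H" "endofunctor C H'"
  shows "nat_iso C (comp_func C F H) (comp_func C F' H') (hcomp F' H a b)"
  unfolding hcomp_def
  by (rule nat_iso_comp_nt[OF nat_iso_whisker_right[OF assms(1)] nat_iso_whisker_left[OF assms(2)]])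
    (simp_all add: assms)

lemma hcomp_id_nt:
  assumes "endofunctor C F" "endofunctor C H"
  shows "hcomp F H (id_nt C F) (id_nt C H) = id_nt C (comp_func C F H)"
  unfolding hcomp_def comp_nt_def[of C "whisker_left C _ _"] id_nt_def[of C "comp_func _ _ _"]
  using assms by (intro restrict_ext) simp

lemma hcomp_comp_nt:
  assumes "nat_iso C F F' a" "nat_iso C F' F'' a'" "nat_iso C H H' b" "nat_iso C H' H'' b'"
    and F: "endofunctor C F" "endofunctor C F'" "endofunctor C F''"
    and H: "endofunctor C H" "endofunctor C H'" "endofunctor C H''"
  shows "hcomp F'' H (comp_nt C a' a) (comp_nt C b' b) =
    comp_nt C (hcomp F'' H' a' b') (hcomp F' H a b)"
  unfolding hcomp_def[of F'' H "comp_nt C a' a"] comp_nt_def[of C "whisker_left C _ _"]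
    comp_nt_def[of C "hcomp _ _ _ _"]
proof (intro restrict_ext)
  note [simp] = F H nat_iso_typing[OF assms(1)] nat_iso_typing[OF assms(2)]
    nat_iso_typing[OF assms(3)] nat_iso_typing[OF assms(4)]
  fix x assume [simp]: "x \<in> Obj C"
  have "a' (omap H' x) \<cdot> mmap F' (b x) \<cdot> a (omap H x) = (a' (omap H' x) \<cdot> mmap F' (b x)) \<cdot> a (omap H x)"
    by simp
  also have "\<dots> = mmap F'' (b x) \<cdot> a' (omap H x) \<cdot> a (omap H x)"
    using naturality[OF nat_iso_trans[OF assms(2)], of "b x"] by simp
  finally show "whisker_left C F'' (comp_nt C b' b) x \<cdot> whisker_right C (comp_nt C a' a) H x =
      hcomp F'' H' a' b' x \<cdot> hcomp F' H a b x"
    by (simp add: endofunctor_Comp)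
qed

lemma comp_nt_assoc:
  assumes "nat_iso C F H a" "nat_iso C H K b" "nat_iso C K L c"
    and "endofunctor C F" "endofunctor C H" "endofunctor C K" "endofunctor C L"
  shows "comp_nt C (comp_nt C c b) a = comp_nt C c (comp_nt C b a)"
  unfolding comp_nt_def[of C "comp_nt C c b" a] comp_nt_def[of C c "comp_nt C b a"]
  using assms(4-) by (intro restrict_ext)
    (simp add: nat_iso_typing[OF assms(1)] nat_iso_typing[OF assms(2)] nat_iso_typing[OF assms(3)])

lemma comp_nt_id_nt [simp]:
  assumes "nat_iso C F H a" "endofunctor C F" "endofunctor C H"
  shows "comp_nt C a (id_nt C F) = a" "comp_nt C (id_nt C H) a = a"
  using assms
  by (auto intro!: nat_trans_eqI[OF nat_iso_trans nat_iso_trans]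
      intro: nat_iso_comp_nt nat_iso_id_nt simp: nat_iso_typing[OF assms(1)])

section \<open>Isomorphism of actions\<close>

lemma group_action_func:
  assumes "(F, \<epsilon>) \<in> group_actions C G" "h \<in> carrier G"
  shows "autoequivalence C (F h)" "endofunctor C (F h)"
  using assms by (auto simp: group_actions_def autoequivalence_def dest!: PiE_mem)

lemma group_action_nat_iso:
  assumes "(F, \<epsilon>) \<in> group_actions C G" "h \<in> carrier G" "k \<in> carrier G"
  shows "nat_iso C (comp_func C (F h) (F k)) (F (h \<otimes>\<^bsub>G\<^esub> k)) (\<epsilon> (h, k))"
proof -
  have "\<epsilon> (h, k) \<in> (case (h, k) of (h, k) \<Rightarrow>
      {\<eta>. nat_iso C (comp_func C (F h) (F k)) (F (h \<otimes>\<^bsub>G\<^esub> k)) \<eta>})"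
    by (rule PiE_mem[of \<epsilon> "carrier G \<times> carrier G"])
      (use assms in \<open>auto simp: group_actions_def\<close>)
  then show ?thesis
    by simp
qed

lemma action_iso_iff:
  "((F, \<epsilon>), (F', \<epsilon>')) \<in> action_iso C G \<longleftrightarrow>
    (F, \<epsilon>) \<in> group_actions C G \<and> (F', \<epsilon>') \<in> group_actions C G \<and>
    (\<exists>\<delta>. (\<forall>h \<in> carrier G. nat_iso C (F h) (F' h) (\<delta> h)) \<and>
      (\<forall>h \<in> carrier G. \<forall>k \<in> carrier G.
        comp_nt C (\<delta> (h \<otimes>\<^bsub>G\<^esub> k)) (\<epsilon> (h, k)) =
        comp_nt C (\<epsilon>' (h, k)) (hcomp (F' h) (F k) (\<delta> h) (\<delta> k))))"
  by (simp add: action_iso_def hcomp_def)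

lemma refl_on_action_iso:
  assumes "group G"
  shows "refl_on (group_actions C G) (action_iso C G)"
proof (rule refl_onI)
  interpret group G by fact
  fix A assume "A \<in> group_actions C G"
  then obtain F \<epsilon> where A: "A = (F, \<epsilon>)" and act: "(F, \<epsilon>) \<in> group_actions C G"
    by (cases A) auto
  note endo = group_action_func(2)[OF act]
  note eps = group_action_nat_iso[OF act]
  have "comp_nt C (id_nt C (F (h \<otimes>\<^bsub>G\<^esub> k))) (\<epsilon> (h, k)) =
      comp_nt C (\<epsilon> (h, k)) (hcomp (F h) (F k) (id_nt C (F h)) (id_nt C (F k)))"
    if "h \<in> carrier G" "k \<in> carrier G" for h k
    using comp_nt_id_nt[OF eps[OF that]] that by (simp add: endo hcomp_id_nt)
  then show "(A, A) \<in> action_iso C G"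
    unfolding A action_iso_iff using act endo
    by (intro conjI exI[of _ "\<lambda>h. id_nt C (F h)"] ballI nat_iso_id_nt) auto
qed

lemma sym_action_iso:
  assumes "group G"
  shows "sym (action_iso C G)"
proof (rule symI)
  interpret group G by fact
  fix A A' assume iso: "(A, A') \<in> action_iso C G"
  obtain F \<epsilon> F' \<epsilon>' where A: "A = (F, \<epsilon>)" "A' = (F', \<epsilon>')"
    by (cases A, cases A')
  from iso obtain \<delta> where act: "(F, \<epsilon>) \<in> group_actions C G" "(F', \<epsilon>') \<in> group_actions C G"
    and \<delta>: "\<And>h. h \<in> carrier G \<Longrightarrow> nat_iso C (F h) (F' h) (\<delta> h)"
    and mult: "\<And>h k. h \<in> carrier G \<Longrightarrow> k \<in> carrier G \<Longrightarrow>
      comp_nt C (\<delta> (h \<otimes>\<^bsub>G\<^esub> k)) (\<epsilon> (h, k)) = comp_nt C (\<epsilon>' (h, k)) (hcomp (F' h) (F k) (\<delta> h) (\<delta> k))"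
    unfolding A action_iso_iff by metis
  note [simp] = group_action_func(2)[OF act(1)] group_action_func(2)[OF act(2)]
  note eps = group_action_nat_iso[OF act(1)] and eps' = group_action_nat_iso[OF act(2)]
  have "\<forall>h. \<exists>\<theta>. h \<in> carrier G \<longrightarrow> nat_iso C (F' h) (F h) \<theta> \<and>
      comp_nt C \<theta> (\<delta> h) = id_nt C (F h) \<and> comp_nt C (\<delta> h) \<theta> = id_nt C (F' h)"
  proof
    fix h
    show "\<exists>\<theta>. h \<in> carrier G \<longrightarrow> nat_iso C (F' h) (F h) \<theta> \<and>
      comp_nt C \<theta> (\<delta> h) = id_nt C (F h) \<and> comp_nt C (\<delta> h) \<theta> = id_nt C (F' h)"
    proof (cases "h \<in> carrier G")
      case True
      obtain \<theta> where "nat_iso C (F' h) (F h) \<theta>"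
          "\<And>x. x \<in> Obj C \<Longrightarrow> \<theta> x \<cdot> \<delta> h x = Ident C (omap (F h) x)"
          "\<And>x. x \<in> Obj C \<Longrightarrow> \<delta> h x \<cdot> \<theta> x = Ident C (omap (F' h) x)"
        using nat_iso_inverse[OF \<delta>[OF True]] True by auto
      then show ?thesis
        by (intro exI[of _ \<theta>]) (auto simp: comp_nt_def id_nt_def)
    qed simp
  qed
  then obtain \<theta> where \<theta>: "\<And>h. h \<in> carrier G \<Longrightarrow> nat_iso C (F' h) (F h) (\<theta> h)"
      and left_inv: "\<And>h. h \<in> carrier G \<Longrightarrow> comp_nt C (\<theta> h) (\<delta> h) = id_nt C (F h)"
      and right_inv: "\<And>h. h \<in> carrier G \<Longrightarrow> comp_nt C (\<delta> h) (\<theta> h) = id_nt C (F' h)"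
    by metis
  have "comp_nt C (\<theta> (h \<otimes>\<^bsub>G\<^esub> k)) (\<epsilon>' (h, k)) = comp_nt C (\<epsilon> (h, k)) (hcomp (F h) (F' k) (\<theta> h) (\<theta> k))"
    if [simp]: "h \<in> carrier G" "k \<in> carrier G" for h k
  proof -
    let ?\<theta> = "hcomp (F h) (F' k) (\<theta> h) (\<theta> k)" and ?\<delta> = "hcomp (F' h) (F k) (\<delta> h) (\<delta> k)"
    note hc\<theta> = nat_iso_hcomp[OF \<theta> \<theta>, of h k] and hc\<delta> = nat_iso_hcomp[OF \<delta> \<delta>, of h k]
    have hk [simp]: "h \<otimes>\<^bsub>G\<^esub> k \<in> carrier G"
      by simp
    have "comp_nt C ?\<delta> ?\<theta> = id_nt C (comp_func C (F' h) (F' k))"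
      using hcomp_comp_nt[OF \<theta>[of h] \<delta>[of h] \<theta>[of k] \<delta>[of k]]
      by (simp add: right_inv hcomp_id_nt)
    then have "\<epsilon>' (h, k) = comp_nt C (\<epsilon>' (h, k)) (comp_nt C ?\<delta> ?\<theta>)"
      using comp_nt_id_nt(1)[OF eps'] by simp
    also have "\<dots> = comp_nt C (comp_nt C (\<delta> (h \<otimes>\<^bsub>G\<^esub> k)) (\<epsilon> (h, k))) ?\<theta>"
      unfolding mult[OF that] by (rule comp_nt_assoc[OF hc\<theta> hc\<delta> eps', symmetric]) simp_all
    also have "\<dots> = comp_nt C (\<delta> (h \<otimes>\<^bsub>G\<^esub> k)) (comp_nt C (\<epsilon> (h, k)) ?\<theta>)"
      by (rule comp_nt_assoc[OF hc\<theta> eps \<delta>]) simp_all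
    finally have "comp_nt C (\<theta> (h \<otimes>\<^bsub>G\<^esub> k)) (\<epsilon>' (h, k)) =
        comp_nt C (\<theta> (h \<otimes>\<^bsub>G\<^esub> k)) (comp_nt C (\<delta> (h \<otimes>\<^bsub>G\<^esub> k)) (comp_nt C (\<epsilon> (h, k)) ?\<theta>))"
      by simp
    also have "\<dots> = comp_nt C (comp_nt C (\<theta> (h \<otimes>\<^bsub>G\<^esub> k)) (\<delta> (h \<otimes>\<^bsub>G\<^esub> k))) (comp_nt C (\<epsilon> (h, k)) ?\<theta>)"
      by (rule comp_nt_assoc[OF nat_iso_comp_nt[OF hc\<theta> eps] \<delta> \<theta>, symmetric]) simp_all
    also have "\<dots> = comp_nt C (\<epsilon> (h, k)) ?\<theta>"
      unfolding left_inv[OF hk] by (rule comp_nt_id_nt(2)[OF nat_iso_comp_nt[OF hc\<theta> eps]]) simp_all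
    finally show ?thesis .
  qed
  then show "(A', A) \<in> action_iso C G"
    unfolding A action_iso_iff using act \<theta> by blast
qed

lemma trans_action_iso:
  assumes "group G"
  shows "trans (action_iso C G)"
proof (rule transI)
  interpret group G by fact
  fix A A' A'' assume iso: "(A, A') \<in> action_iso C G" "(A', A'') \<in> action_iso C G"
  obtain F \<epsilon> F' \<epsilon>' F'' \<epsilon>'' where A: "A = (F, \<epsilon>)" "A' = (F', \<epsilon>')" "A'' = (F'', \<epsilon>'')"
    by (cases A, cases A', cases A'')
  from iso(1) obtain \<delta> where act: "(F, \<epsilon>) \<in> group_actions C G" "(F', \<epsilon>') \<in> group_actions C G"
    and \<delta>: "\<And>h. h \<in> carrier G \<Longrightarrow> nat_iso C (F h) (F' h) (\<delta> h)"
    and mult: "\<And>h k. h \<in> carrier G \<Longrightarrow> k \<in> carrier G \<Longrightarrow>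
      comp_nt C (\<delta> (h \<otimes>\<^bsub>G\<^esub> k)) (\<epsilon> (h, k)) = comp_nt C (\<epsilon>' (h, k)) (hcomp (F' h) (F k) (\<delta> h) (\<delta> k))"
    unfolding A action_iso_iff by metis
  from iso(2) obtain \<delta>' where act'': "(F'', \<epsilon>'') \<in> group_actions C G"
    and \<delta>': "\<And>h. h \<in> carrier G \<Longrightarrow> nat_iso C (F' h) (F'' h) (\<delta>' h)"
    and mult': "\<And>h k. h \<in> carrier G \<Longrightarrow> k \<in> carrier G \<Longrightarrow>
      comp_nt C (\<delta>' (h \<otimes>\<^bsub>G\<^esub> k)) (\<epsilon>' (h, k)) = comp_nt C (\<epsilon>'' (h, k)) (hcomp (F'' h) (F' k) (\<delta>' h) (\<delta>' k))"
    unfolding A action_iso_iff by metis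
  note [simp] = group_action_func(2)[OF act(1)] group_action_func(2)[OF act(2)]
    group_action_func(2)[OF act'']
  note eps = group_action_nat_iso[OF act(1)] and eps' = group_action_nat_iso[OF act(2)]
    and eps'' = group_action_nat_iso[OF act'']
  define \<theta> where "\<theta> h = comp_nt C (\<delta>' h) (\<delta> h)" for h
  have \<theta>: "nat_iso C (F h) (F'' h) (\<theta> h)" if "h \<in> carrier G" for h
    unfolding \<theta>_def using that by (intro nat_iso_comp_nt[OF \<delta> \<delta>']) simp_all
  have "comp_nt C (\<theta> (h \<otimes>\<^bsub>G\<^esub> k)) (\<epsilon> (h, k)) = comp_nt C (\<epsilon>'' (h, k)) (hcomp (F'' h) (F k) (\<theta> h) (\<theta> k))"
    if [simp]: "h \<in> carrier G" "k \<in> carrier G" for h k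
  proof -
    let ?\<delta>' = "hcomp (F'' h) (F' k) (\<delta>' h) (\<delta>' k)" and ?\<delta> = "hcomp (F' h) (F k) (\<delta> h) (\<delta> k)"
    note hc\<delta>' = nat_iso_hcomp[OF \<delta>' \<delta>', of h k] and hc\<delta> = nat_iso_hcomp[OF \<delta> \<delta>, of h k]
    have "comp_nt C (\<theta> (h \<otimes>\<^bsub>G\<^esub> k)) (\<epsilon> (h, k)) = comp_nt C (\<delta>' (h \<otimes>\<^bsub>G\<^esub> k)) (comp_nt C (\<epsilon>' (h, k)) ?\<delta>)"
      unfolding \<theta>_def mult[OF that, symmetric] by (rule comp_nt_assoc[OF eps \<delta> \<delta>']) simp_all
    also have "\<dots> = comp_nt C (comp_nt C (\<delta>' (h \<otimes>\<^bsub>G\<^esub> k)) (\<epsilon>' (h, k))) ?\<delta>"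
      by (rule comp_nt_assoc[OF hc\<delta> eps' \<delta>', symmetric]) simp_all
    also have "\<dots> = comp_nt C (\<epsilon>'' (h, k)) (comp_nt C ?\<delta>' ?\<delta>)"
      unfolding mult'[OF that] by (rule comp_nt_assoc[OF hc\<delta> hc\<delta>' eps'']) simp_all
    also have "comp_nt C ?\<delta>' ?\<delta> = hcomp (F'' h) (F k) (\<theta> h) (\<theta> k)"
      unfolding \<theta>_def by (rule hcomp_comp_nt[OF \<delta> \<delta>' \<delta> \<delta>', symmetric]) simp_all
    finally show ?thesis .
  qed
  then show "(A, A'') \<in> action_iso C G"
    unfolding A action_iso_iff using act act'' \<theta> by blast
qed

lemma equiv_action_iso:
  assumes "group G"
  shows "equiv (group_actions C G) (action_iso C G)"
proof (rule equivI)
  show "action_iso C G \<subseteq> group_actions C G \<times> group_actions C G"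
    by (auto simp: action_iso_def)
qed (simp_all add: assms refl_on_action_iso sym_action_iso trans_action_iso)

section \<open>Powers of an isomorphism of functors\<close>

text \<open>The recursion of powers extends to the step from \<open>0\<close> to \<open>1\<close>, since \<open>F\<close> preserves
  identities.\<close>

lemma nt_power_Suc:
  assumes "nat_iso C F F' a" "endofunctor C F" "endofunctor C F'"
  shows "nt_power C F F' a (Suc n) =
    comp_nt C (whisker_right C a (func_power C F' n)) (whisker_left C F (nt_power C F F' a n))"
proof (cases n)
  case 0
  have "a = (\<lambda>x\<in>Obj C. a x)"
    using assms(1) by (auto simp: nat_iso_def nat_trans_def PiE_def extensional_restrict)
  also have "\<dots> = comp_nt C (whisker_right C a (func_power C F' 0)) (whisker_left C F (nt_power C F F' a 0))"
    unfolding comp_nt_def using assms nat_iso_typing[OF assms(1)]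
    by (intro restrict_ext) simp
  finally show ?thesis
    using 0 by simp
qed simp

lemma nat_iso_nt_power:
  assumes "nat_iso C F F' a" "endofunctor C F" "endofunctor C F'"
  shows "nat_iso C (func_power C F n) (func_power C F' n) (nt_power C F F' a n)"
proof (induction n)
  case 0
  then show ?case
    by (simp add: nat_iso_id_nt)
next
  case (Suc n)
  show ?case
    unfolding nt_power_Suc[OF assms] func_power.simps
    using nat_iso_comp_nt[OF nat_iso_whisker_left[OF Suc] nat_iso_whisker_right[OF assms(1)]]
      assms by simp
qed

text \<open>The recursion for \<open>a\<^bsup>m + 1\<^esup>\<close> applies \<open>F a\<^sup>m\<close> before \<open>a\<close>. Naturality of \<open>a\<close> exchanges the
  two, which makes the splitting of the exponent symmetric.\<close>

lemma nt_power_add: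
  assumes a: "nat_iso C F F' a" "endofunctor C F" "endofunctor C F'" and x: "x \<in> Obj C"
  shows "nt_power C F F' a (m + n) x =
    mmap (func_power C F' m) (nt_power C F F' a n x) \<cdot> nt_power C F F' a m (omap (func_power C F n) x)"
proof (induction m)
  case 0
  then show ?case
    using assms nat_iso_typing[OF nat_iso_nt_power[OF a]] by simp
next
  case (Suc m)
  note [simp] = assms(2-) nat_iso_typing[OF nat_iso_nt_power[OF a]] nat_iso_typing[OF a(1)]
    func_power_add_simps
  let ?a = "nt_power C F F' a"
  let ?f = "mmap (func_power C F' m) (?a n x)" and ?k = "?a m (omap (func_power C F n) x)"
  have "?a (Suc m + n) x = a (omap (func_power C F' (m + n)) x) \<cdot> mmap F ?f \<cdot> mmap F ?k"
    by (simp add: nt_power_Suc[OF a] Suc endofunctor_Comp)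
  also have "\<dots> = (a (omap (func_power C F' (m + n)) x) \<cdot> mmap F ?f) \<cdot> mmap F ?k"
    by simp
  also have "\<dots> = (mmap F' ?f \<cdot> a (omap (func_power C F' m) (omap (func_power C F n) x))) \<cdot> mmap F ?k"
    by (subst naturality[OF nat_iso_trans[OF a(1)], where f = ?f
          and x = "omap (func_power C F' m) (omap (func_power C F n) x)"]) simp_all
  finally show ?case
    by (simp add: nt_power_Suc[OF a])
qed

end

section \<open>Reduction of exponents along a compatible pair\<close>

locale compatible_pair = category C for C :: "('o, 'm) cat" +
  fixes d :: nat and F :: "('o, 'm) func" and c :: "'o \<Rightarrow> 'm"
  assumes pair: "(F, c) \<in> compatible_pairs C d"
    and d_pos: "0 < d"
begin

abbreviation pow :: "nat \<Rightarrow> ('o, 'm) func" where "pow n \<equiv> func_power C F n"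

lemma F_endo [simp]: "endofunctor C F"
  using pair by (simp add: compatible_pairs_def)

lemma c_iso: "nat_iso C (pow d) (id_func C) c"
  using pair by (simp add: compatible_pairs_def)

lemma c_typing [simp]:
  assumes "x \<in> Obj C"
  shows "c x \<in> Mor C" "Dom C (c x) = omap (pow d) x" "Cod C (c x) = x"
  using nat_iso_typing[OF c_iso assms] assms by simp_all

lemmas pow_simps [simp] = func_power_add_simps[OF F_endo]

lemma c_compat: "x \<in> Obj C \<Longrightarrow> mmap F (c x) = c (omap F x)"
  using pair unfolding compatible_pairs_def by (auto dest: fun_cong[of _ _ x])

lemma c_pow: "x \<in> Obj C \<Longrightarrow> c (omap (pow n) x) = mmap (pow n) (c x)"
  by (induction n) (simp_all flip: c_compat)

text \<open>The isomorphism \<open>F\<^sup>n \<rightarrow> F\<^bsup>n mod d\<^esup>\<close> that cancels blocks of \<open>d\<close> factors by \<open>c\<close>. The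
  structure isomorphism of the induced action at \<open>(g\<^sup>i, g\<^sup>j)\<close> is its instance \<open>n = i + j\<close>;
  allowing arbitrary \<open>n\<close> replaces the case distinctions on carries by inductions.\<close>

fun reduce :: "nat \<Rightarrow> 'o \<Rightarrow> 'm" where
  "reduce n = (if d = 0 \<or> n < d then id_nt C (pow n)
    else comp_nt C (reduce (n - d)) (whisker_left C (pow (n - d)) c))"

declare reduce.simps [simp del]

lemma reduce_less: "n < d \<Longrightarrow> reduce n = id_nt C (pow n)"
  by (simp add: reduce.simps)

lemma reduce_step: "reduce (n + d) = comp_nt C (reduce n) (whisker_left C (pow n) c)"
  using d_pos by (subst reduce.simps) simp

lemma add_d_induct [case_names less step]:
  assumes "\<And>n. n < d \<Longrightarrow> P n" and "\<And>n. P n \<Longrightarrow> P (n + d)"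
  shows "P n"
proof (induction n rule: less_induct)
  case (less n)
  show ?case
  proof (cases "n < d")
    case False
    then have "P (n - d + d)"
      using less d_pos by (intro assms(2)) simp
    then show ?thesis
      using False by simp
  qed (rule assms(1))
qed

lemma nat_iso_reduce: "nat_iso C (pow n) (pow (n mod d)) (reduce n)"
proof (induction n rule: add_d_induct)
  case (less n)
  then show ?case
    by (simp add: reduce_less nat_iso_id_nt)
next
  case (step n)
  have "nat_iso C (pow (n + d)) (pow n) (whisker_left C (pow n) c)"
    using nat_iso_whisker_left[OF c_iso, of "pow n"] by (simp add: func_power_add[of F n d])
  then show ?case
    unfolding reduce_step mod_add_self2 by (rule nat_iso_comp_nt[OF _ step]) simp_all
qed

lemmas reduce_typing [simp] = nat_iso_typing[OF nat_iso_reduce]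

lemma reduce_step_apply: "x \<in> Obj C \<Longrightarrow> reduce (n + d) x = reduce n x \<cdot> mmap (pow n) (c x)"
  by (simp add: reduce_step)

text \<open>In a product \<open>F\<^sup>m F\<^sup>n\<close> either factor may be reduced first. Reducing the left one first
  uses \<open>c F\<^sup>n = F\<^sup>n c\<close>, and it is the only place where the compatibility \<open>F c = c F\<close> enters.\<close>

lemma reduce_add_left:
  assumes [simp]: "x \<in> Obj C"
  shows "reduce (m + n) x = reduce (m mod d + n) x \<cdot> reduce m (omap (pow n) x)"
proof (induction m rule: add_d_induct)
  case (less m)
  then show ?case
    by (simp add: reduce_less)
next
  case (step m)
  have "reduce (m + d + n) x = reduce (m + n) x \<cdot> mmap (pow (m + n)) (c x)"
    using reduce_step_apply[of x "m + n"] by (simp add: ac_simps)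
  also have "\<dots> = reduce (m mod d + n) x \<cdot> reduce m (omap (pow n) x) \<cdot> mmap (pow (m + n)) (c x)"
    by (simp add: step ac_simps)
  finally show ?case
    by (simp add: reduce_step_apply c_pow)
qed

lemma reduce_add_right:
  assumes [simp]: "x \<in> Obj C"
  shows "reduce (m + n) x = reduce (m + n mod d) x \<cdot> mmap (pow m) (reduce n x)"
proof (induction n rule: add_d_induct)
  case (less n)
  then show ?case
    by (simp add: reduce_less)
next
  case (step n)
  have "reduce (m + (n + d)) x = reduce (m + n) x \<cdot> mmap (pow (m + n)) (c x)"
    using reduce_step_apply[of x "m + n"] by (simp add: ac_simps)
  then show ?case
    by (simp add: step reduce_step_apply endofunctor_Comp)
qed

lemma autoequivalence_pow:
  assumes "n \<le> d"
  shows "autoequivalence C (pow n)"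
  unfolding autoequivalence_def
  using assms c_iso func_power_add[OF F_endo, of n "d - n"] func_power_add[OF F_endo, of "d - n" n]
  by (intro conjI exI[of _ "pow (d - n)"] exI[of _ c]) simp_all

end

text \<open>An isomorphism of compatible pairs commutes with reduction; the hypothesis on \<open>c\<close>
  and \<open>c'\<close> is its instance \<open>n = d\<close>.\<close>

lemma (in category) nt_power_reduce:
  assumes "compatible_pair C d F c" "compatible_pair C d F' c'" "nat_iso C F F' a"
    and c: "c = comp_nt C c' (nt_power C F F' a d)" and x [simp]: "x \<in> Obj C"
  shows "nt_power C F F' a (n mod d) x \<cdot> compatible_pair.reduce C d F c n x =
    compatible_pair.reduce C d F' c' n x \<cdot> nt_power C F F' a n x"
proof -
  interpret P: compatible_pair C d F c by fact
  interpret P': compatible_pair C d F' c' by fact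
  note a = assms(3) P.F_endo P'.F_endo
  note [simp] = nat_iso_typing[OF nat_iso_nt_power[OF a]]
  let ?a = "nt_power C F F' a"
  show ?thesis
  proof (induction n rule: P.add_d_induct)
    case (less n)
    then show ?case
      by (simp add: P.reduce_less P'.reduce_less)
  next
    case (step n)
    have cx: "c x = c' x \<cdot> ?a d x"
      by (subst c) simp
    have "?a (n mod d) x \<cdot> P.reduce (n + d) x = (?a (n mod d) x \<cdot> P.reduce n x) \<cdot> mmap (P.pow n) (c x)"
      by (simp add: P.reduce_step_apply)
    also have "\<dots> = P'.reduce n x \<cdot> ?a n x \<cdot> mmap (P.pow n) (c x)"
      by (simp add: step)
    also have "?a n x \<cdot> mmap (P.pow n) (c x) = mmap (P'.pow n) (c x) \<cdot> ?a n (omap (P.pow d) x)"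
      by (rule naturality[OF nat_iso_trans[OF nat_iso_nt_power[OF a]]]) simp_all
    also have "\<dots> = mmap (P'.pow n) (c' x) \<cdot> ?a (n + d) x"
      by (simp add: cx endofunctor_Comp nt_power_add[OF a])
    finally show ?case
      by (simp add: P'.reduce_step_apply)
  qed
qed

section \<open>Induced actions\<close>

locale category_cyclic_group = category C + group G
  for C :: "('o, 'm) cat" and G :: "('g, 'r) monoid_scheme" +
  fixes g :: 'g and d :: nat
  assumes d_ge_2: "2 \<le> d"
    and order: "order G = d"
    and g_closed [simp]: "g \<in> carrier G"
    and carrier_eq: "carrier G = {g [^]\<^bsub>G\<^esub> i | i :: nat. i < d}"
begin

lemma pow_mod: "g [^]\<^bsub>G\<^esub> (n mod d) = g [^]\<^bsub>G\<^esub> n"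
proof -
  have "g [^]\<^bsub>G\<^esub> n = g [^]\<^bsub>G\<^esub> (d * (n div d) + n mod d)"
    by simp
  also have "\<dots> = (g [^]\<^bsub>G\<^esub> d) [^]\<^bsub>G\<^esub> (n div d) \<otimes>\<^bsub>G\<^esub> g [^]\<^bsub>G\<^esub> (n mod d)"
    by (simp only: nat_pow_mult[OF g_closed, symmetric] nat_pow_pow[OF g_closed])
  finally show ?thesis
    using pow_order_eq_1[OF g_closed] order by simp
qed

lemma inj_on_pow: "inj_on (\<lambda>i::nat. g [^]\<^bsub>G\<^esub> i) {..<d}"
proof (rule eq_card_imp_inj_on)
  have "(\<lambda>i::nat. g [^]\<^bsub>G\<^esub> i) ` {..<d} = carrier G"
    by (auto simp: carrier_eq)
  then show "card ((\<lambda>i::nat. g [^]\<^bsub>G\<^esub> i) ` {..<d}) = card {..<d}"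
    using order by (simp add: order_def)
qed simp

lemma exponent_pow [simp]: "exponent G g d (g [^]\<^bsub>G\<^esub> n) = n mod d"
  unfolding exponent_def
proof (rule the_equality)
  show "n mod d < d \<and> g [^]\<^bsub>G\<^esub> n = g [^]\<^bsub>G\<^esub> (n mod d)"
    using d_ge_2 by (simp add: pow_mod)
  fix i assume "i < d \<and> g [^]\<^bsub>G\<^esub> n = g [^]\<^bsub>G\<^esub> i"
  then show "i = n mod d"
    using d_ge_2 by (intro inj_onD[OF inj_on_pow]) (auto simp: pow_mod)
qed

lemma carrierE:
  assumes "h \<in> carrier G"
  obtains i where "i < d" "h = g [^]\<^bsub>G\<^esub> i"
  using assms carrier_eq by auto

lemma compatible_pairI: "(F, c) \<in> compatible_pairs C d \<Longrightarrow> compatible_pair C d F c"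
  using d_ge_2 by unfold_locales simp_all

text \<open>The two components of an induced action serve as names for its functors and its
  structure isomorphisms.\<close>

lemma induced_action_pair:
  "induced_action C G g d (F, c) =
    (fst (induced_action C G g d (F, c)), snd (induced_action C G g d (F, c)))"
  by simp

lemma induced_action_func [simp]:
  "i < d \<Longrightarrow> fst (induced_action C G g d (F, c)) (g [^]\<^bsub>G\<^esub> i) = func_power C F i"
  by (simp add: induced_action_def)

lemma induced_action_structure:
  assumes "(F, c) \<in> compatible_pairs C d" "i < d" "j < d"
  shows "snd (induced_action C G g d (F, c)) (g [^]\<^bsub>G\<^esub> i, g [^]\<^bsub>G\<^esub> j) =
    compatible_pair.reduce C d F c (i + j)"
proof -
  interpret compatible_pair C d F c
    using assms(1) by (rule compatible_pairI)
  show ?thesis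
  proof (cases "i + j < d")
    case True
    then show ?thesis
      using assms by (simp add: induced_action_def reduce_less)
  next
    case False
    define k where "k = i + j - d"
    have k: "i + j = k + d" "k < d"
      using False assms by (auto simp: k_def)
    have "nat_iso C (pow (k + d)) (pow k) (whisker_left C (pow k) c)"
      using nat_iso_whisker_left[OF c_iso, of "pow k"] by (simp add: func_power_add[of F k d])
    then have "reduce (k + d) = whisker_left C (pow k) c"
      unfolding reduce_step reduce_less[OF k(2)] by (rule comp_nt_id_nt(2)) simp_all
    then show ?thesis
      using assms k by (simp add: induced_action_def)
  qed
qed

text \<open>The cocycle condition at \<open>(g\<^sup>i, g\<^sup>j, g\<^sup>l)\<close> says that both ways of reducing
  \<open>F\<^sup>i F\<^sup>j F\<^sup>l\<close> agree with the reduction of \<open>F\<^bsup>i + j + l\<^esup>\<close> in one go.\<close>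

lemma induced_action_in_group_actions:
  assumes "(F, c) \<in> compatible_pairs C d"
  shows "induced_action C G g d (F, c) \<in> group_actions C G"
proof -
  interpret compatible_pair C d F c
    using assms by (rule compatible_pairI)
  let ?F = "fst (induced_action C G g d (F, c))" and ?\<epsilon> = "snd (induced_action C G g d (F, c))"
  note eps = induced_action_structure[OF assms]
  have mult: "g [^]\<^bsub>G\<^esub> i \<otimes>\<^bsub>G\<^esub> g [^]\<^bsub>G\<^esub> j = g [^]\<^bsub>G\<^esub> ((i + j) mod d)" for i j :: nat
    by (simp add: pow_mod nat_pow_mult)
  have lt [simp]: "n mod d < d" for n
    using d_pos by simp
  have "autoequivalence C (?F h)" if h: "h \<in> carrier G" for h
    using h by (elim carrierE) (simp add: autoequivalence_pow)
  moreover have "nat_iso C (comp_func C (?F h) (?F k)) (?F (h \<otimes>\<^bsub>G\<^esub> k)) (?\<epsilon> (h, k))"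
    if hk: "h \<in> carrier G" "k \<in> carrier G" for h k
  proof -
    obtain i j where ij: "i < d" "h = g [^]\<^bsub>G\<^esub> i" "j < d" "k = g [^]\<^bsub>G\<^esub> j"
      using hk by (metis carrierE)
    show ?thesis
      using nat_iso_reduce[of "i + j"] ij by (simp add: mult eps func_power_add)
  qed
  moreover have "comp_nt C (?\<epsilon> (h \<otimes>\<^bsub>G\<^esub> k, l)) (whisker_right C (?\<epsilon> (h, k)) (?F l)) =
      comp_nt C (?\<epsilon> (h, k \<otimes>\<^bsub>G\<^esub> l)) (whisker_left C (?F h) (?\<epsilon> (k, l)))"
    if hkl: "h \<in> carrier G" "k \<in> carrier G" "l \<in> carrier G" for h k l
  proof -
    obtain i j n where ij: "i < d" "h = g [^]\<^bsub>G\<^esub> i" "j < d" "k = g [^]\<^bsub>G\<^esub> j" "n < d" "l = g [^]\<^bsub>G\<^esub> n"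
      using hkl by (metis carrierE)
    have "reduce ((i + j) mod d + n) x \<cdot> reduce (i + j) (omap (pow n) x) =
        reduce (i + (j + n) mod d) x \<cdot> mmap (pow i) (reduce (j + n) x)" if "x \<in> Obj C" for x
      using reduce_add_left[OF that, of "i + j" n] reduce_add_right[OF that, of i "j + n"]
      by (simp add: ac_simps)
    then show ?thesis
      using ij unfolding comp_nt_def by (intro restrict_ext) (simp add: mult eps)
  qed
  moreover have "?F \<in> extensional (carrier G)" "?\<epsilon> \<in> extensional (carrier G \<times> carrier G)"
    by (simp_all add: induced_action_def)
  ultimately show ?thesis
    unfolding group_actions_def by (subst induced_action_pair) (auto simp: PiE_def)
qed

text \<open>At \<open>(g\<^sup>i, g\<^sup>j)\<close> the horizontal composite of \<open>a\<^sup>i\<close> and \<open>a\<^sup>j\<close> is \<open>a\<^bsup>i + j\<^esup>\<close>, so that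
  multiplicativity of \<open>g\<^sup>i \<mapsto> a\<^sup>i\<close> is the commutation of \<open>a\<^bsup>i + j\<^esup>\<close> with reduction.\<close>

lemma induced_action_iso_of_pair_iso:
  assumes "((F, c), (F', c')) \<in> pair_iso C d"
  shows "(induced_action C G g d (F, c), induced_action C G g d (F', c')) \<in> action_iso C G"
proof -
  from assms obtain a where mem: "(F, c) \<in> compatible_pairs C d" "(F', c') \<in> compatible_pairs C d"
    and a: "nat_iso C F F' a" and c: "c = comp_nt C c' (nt_power C F F' a d)"
    by (auto simp: pair_iso_def)
  interpret P: compatible_pair C d F c using mem(1) by (rule compatible_pairI)
  interpret P': compatible_pair C d F' c' using mem(2) by (rule compatible_pairI)
  note a' = a P.F_endo P'.F_endo
  let ?F = "fst (induced_action C G g d (F, c))" and ?\<epsilon> = "snd (induced_action C G g d (F, c))"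
  let ?F' = "fst (induced_action C G g d (F', c'))" and ?\<epsilon>' = "snd (induced_action C G g d (F', c'))"
  let ?\<delta> = "\<lambda>h. nt_power C F F' a (exponent G g d h)"
  have "nat_iso C (?F h) (?F' h) (?\<delta> h)" if h: "h \<in> carrier G" for h
    using h by (elim carrierE) (simp add: nat_iso_nt_power[OF a'])
  moreover have "comp_nt C (?\<delta> (h \<otimes>\<^bsub>G\<^esub> k)) (?\<epsilon> (h, k)) =
      comp_nt C (?\<epsilon>' (h, k)) (hcomp (?F' h) (?F k) (?\<delta> h) (?\<delta> k))"
    if hk: "h \<in> carrier G" "k \<in> carrier G" for h k
  proof -
    obtain i j where ij: "i < d" "h = g [^]\<^bsub>G\<^esub> i" "j < d" "k = g [^]\<^bsub>G\<^esub> j"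
      using hk by (metis carrierE)
    show ?thesis
      using ij unfolding comp_nt_def
      by (intro restrict_ext) (simp add: nat_pow_mult induced_action_structure mem nt_power_add[OF a', symmetric]
          nt_power_reduce[OF P.compatible_pair_axioms P'.compatible_pair_axioms a c])
  qed
  moreover have "(?F, ?\<epsilon>) \<in> group_actions C G" "(?F', ?\<epsilon>') \<in> group_actions C G"
    using induced_action_in_group_actions mem by simp_all
  ultimately have "((?F, ?\<epsilon>), (?F', ?\<epsilon>')) \<in> action_iso C G"
    unfolding action_iso_iff by (intro conjI exI[of _ ?\<delta>] ballI)
  then show ?thesis
    by simp
qed

text \<open>An isomorphism \<open>\<delta>\<close> of induced actions is determined by its component \<open>a\<close> at the
  generator: as long as no block of \<open>d\<close> factors is cancelled, multiplicativity forces
  \<open>\<delta>\<close> to be \<open>a\<^sup>i\<close> at \<open>g\<^sup>i\<close>. Cancelling the first block, at \<open>(g, g\<^bsup>d - 1\<^esup>)\<close>, is the equation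
  that makes \<open>a\<close> an isomorphism of pairs.\<close>

lemma pair_iso_of_induced_action_iso:
  assumes mem: "(F, c) \<in> compatible_pairs C d" "(F', c') \<in> compatible_pairs C d"
    and iso: "(induced_action C G g d (F, c), induced_action C G g d (F', c')) \<in> action_iso C G"
  shows "((F, c), (F', c')) \<in> pair_iso C d"
proof -
  interpret P: compatible_pair C d F c using mem(1) by (rule compatible_pairI)
  interpret P': compatible_pair C d F' c' using mem(2) by (rule compatible_pairI)
  let ?F = "fst (induced_action C G g d (F, c))" and ?\<epsilon> = "snd (induced_action C G g d (F, c))"
  let ?F' = "fst (induced_action C G g d (F', c'))" and ?\<epsilon>' = "snd (induced_action C G g d (F', c'))"
  have "((?F, ?\<epsilon>), (?F', ?\<epsilon>')) \<in> action_iso C G"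
    using iso by simp
  then obtain \<delta> where \<delta>: "\<And>h. h \<in> carrier G \<Longrightarrow> nat_iso C (?F h) (?F' h) (\<delta> h)"
    and mult: "\<And>h k. h \<in> carrier G \<Longrightarrow> k \<in> carrier G \<Longrightarrow>
      comp_nt C (\<delta> (h \<otimes>\<^bsub>G\<^esub> k)) (?\<epsilon> (h, k)) = comp_nt C (?\<epsilon>' (h, k)) (hcomp (?F' h) (?F k) (\<delta> h) (\<delta> k))"
    unfolding action_iso_iff by metis
  define b where "b i = \<delta> (g [^]\<^bsub>G\<^esub> i)" for i :: nat
  have b: "nat_iso C (P.pow i) (P'.pow i) (b i)" if "i < d" for i
    using \<delta>[of "g [^]\<^bsub>G\<^esub> i"] that by (simp add: b_def)
  have b_mult: "b ((i + j) mod d) x \<cdot> P.reduce (i + j) x =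
      P'.reduce (i + j) x \<cdot> mmap (P'.pow i) (b j x) \<cdot> b i (omap (P.pow j) x)"
    if "i < d" "j < d" "x \<in> Obj C" for i j x
    using fun_cong[OF mult[of "g [^]\<^bsub>G\<^esub> i" "g [^]\<^bsub>G\<^esub> j"], of x] that mem
    by (simp add: b_def nat_pow_mult pow_mod induced_action_structure)
  define a where "a = b (Suc 0)"
  have one: "Suc 0 < d" "0 < d"
    using d_ge_2 by auto
  have a: "nat_iso C F F' a"
    using b[OF one(1)] by (simp add: a_def)
  note a' = a P.F_endo P'.F_endo
  note [simp] = nat_iso_typing[OF nat_iso_nt_power[OF a']] nat_iso_typing[OF a]
  \<comment> \<open>Multiplicativity at the unit makes the isomorphism \<open>b 0\<close> idempotent.\<close>
  have b0: "b 0 x = Ident C x" if [simp]: "x \<in> Obj C" for x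
  proof (rule iso_mor_cancel_left[OF nat_iso_iso_mor[OF b[OF one(2)] that]])
    show "b 0 x \<cdot> b 0 x = b 0 x \<cdot> Ident C x"
      using b_mult[OF one(2) one(2) that] nat_iso_typing[OF b[OF one(2)] that] one
      by (simp add: P.reduce_less P'.reduce_less)
  qed (use nat_iso_typing[OF b[OF one(2)] that] in simp_all)
  have b_pow: "b i x = nt_power C F F' a i x" if "i < d" "x \<in> Obj C" for i x
    using that
  proof (induction i)
    case 0
    then show ?case
      by (simp add: b0)
  next
    case (Suc i)
    have "b (Suc i) x = mmap F' (nt_power C F F' a i x) \<cdot> a (omap (P.pow i) x)"
      using b_mult[of "Suc 0" i x] Suc nat_iso_typing[OF b[of "Suc i"]] one
      by (simp add: P.reduce_less P'.reduce_less a_def[symmetric])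
    then show ?case
      using nt_power_add[OF a', of x "Suc 0" i] Suc by simp
  qed
  \<comment> \<open>Here \<open>1 + (d - 1) = d\<close> and \<open>reduce d = c\<close>, while \<open>b (d mod d)\<close> is the identity.\<close>
  have "c x = c' x \<cdot> nt_power C F F' a d x" if [simp]: "x \<in> Obj C" for x
    using b_mult[of "Suc 0" "d - 1" x] nt_power_add[OF a', of x "Suc 0" "d - 1"] b0[of x] one
      P.reduce_step_apply[of x 0] P'.reduce_step_apply[of x 0]
    by (simp add: b_pow P.reduce_less P'.reduce_less a_def[symmetric])
  then have "c = comp_nt C c' (nt_power C F F' a d)"
    by (intro nat_trans_eqI[OF nat_iso_trans[OF P.c_iso]
        nat_iso_trans[OF nat_iso_comp_nt[OF nat_iso_nt_power[OF a'] P'.c_iso]]]) simp_all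
  then show ?thesis
    using mem a by (auto simp: pair_iso_def)
qed

end

section \<open>Units of actions\<close>

context category
begin

lemma group_action_cocycle:
  assumes "(E, \<epsilon>) \<in> group_actions C G" "h \<in> carrier G" "k \<in> carrier G" "l \<in> carrier G" "x \<in> Obj C"
  shows "\<epsilon> (h \<otimes>\<^bsub>G\<^esub> k, l) x \<cdot> \<epsilon> (h, k) (omap (E l) x) =
    \<epsilon> (h, k \<otimes>\<^bsub>G\<^esub> l) x \<cdot> mmap (E h) (\<epsilon> (k, l) x)"
proof -
  have "\<forall>h \<in> carrier G. \<forall>k \<in> carrier G. \<forall>l \<in> carrier G.
      comp_nt C (\<epsilon> (h \<otimes>\<^bsub>G\<^esub> k, l)) (whisker_right C (\<epsilon> (h, k)) (E l)) =
      comp_nt C (\<epsilon> (h, k \<otimes>\<^bsub>G\<^esub> l)) (whisker_left C (E h) (\<epsilon> (k, l)))"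
    using assms(1) unfolding group_actions_def mem_Collect_eq prod.case by (elim conjE)
  then have "comp_nt C (\<epsilon> (h \<otimes>\<^bsub>G\<^esub> k, l)) (whisker_right C (\<epsilon> (h, k)) (E l)) x =
      comp_nt C (\<epsilon> (h, k \<otimes>\<^bsub>G\<^esub> l)) (whisker_left C (E h) (\<epsilon> (k, l))) x"
    using assms(2-4) by (metis (no_types))
  then show ?thesis
    by (simp only: comp_nt_apply[OF assms(5)] whisker_left_apply[OF assms(5)]
        whisker_right_apply[OF assms(5)])
qed

text \<open>Since \<open>E\<^sub>1\<close> is an equivalence, the structure isomorphism \<open>E\<^sub>1 E\<^sub>1 \<rightarrow> E\<^sub>1\<close> is the image
  under \<open>E\<^sub>1\<close> of an isomorphism \<open>u : E\<^sub>1 \<rightarrow> Id\<close>. A quasi-inverse \<open>H\<close> gives a formula for \<open>u\<close>: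
  \<open>E\<^sub>1 \<rightarrow> H E\<^sub>1 E\<^sub>1 \<rightarrow> H E\<^sub>1 \<rightarrow> Id\<close>.\<close>

lemma group_action_unit:
  assumes "group G" and act: "(E, \<epsilon>) \<in> group_actions C G"
  obtains u where "nat_iso C (E \<one>\<^bsub>G\<^esub>) (id_func C) u"
    "\<And>x. x \<in> Obj C \<Longrightarrow> mmap (E \<one>\<^bsub>G\<^esub>) (u x) = \<epsilon> (\<one>\<^bsub>G\<^esub>, \<one>\<^bsub>G\<^esub>) x"
proof -
  interpret group G by fact
  let ?E = "E \<one>\<^bsub>G\<^esub>" and ?\<epsilon> = "\<epsilon> (\<one>\<^bsub>G\<^esub>, \<one>\<^bsub>G\<^esub>)"
  have [simp]: "endofunctor C ?E"
    using group_action_func(2)[OF act] by simp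
  obtain H \<eta> \<theta> where [simp]: "endofunctor C H" and \<eta>: "nat_iso C (comp_func C ?E H) (id_func C) \<eta>"
    and \<theta>: "nat_iso C (comp_func C H ?E) (id_func C) \<theta>"
    using group_action_func(1)[OF act one_closed] unfolding autoequivalence_def by blast
  obtain \<theta>' where \<theta>': "nat_iso C (id_func C) (comp_func C H ?E) \<theta>'"
    and \<theta>'\<theta>: "\<And>x. x \<in> Obj C \<Longrightarrow> \<theta>' x \<cdot> \<theta> x = Ident C (omap (comp_func C H ?E) x)"
    by (rule nat_iso_inverse[OF \<theta>]) simp_all
  have eps: "nat_iso C (comp_func C ?E ?E) ?E ?\<epsilon>"
    using group_action_nat_iso[OF act one_closed one_closed] by simp
  define u where "u = comp_nt C \<theta> (comp_nt C (whisker_left C H ?\<epsilon>) (whisker_right C \<theta>' ?E))"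
  have "nat_iso C ?E (comp_func C H (comp_func C ?E ?E)) (whisker_right C \<theta>' ?E)"
    using nat_iso_whisker_right[OF \<theta>', of ?E] by (simp add: comp_func_assoc)
  then have u: "nat_iso C ?E (id_func C) u"
    unfolding u_def
    by (rule nat_iso_comp_nt[OF nat_iso_comp_nt[OF _ nat_iso_whisker_left[OF eps]] \<theta>]) simp_all
  note [simp] = nat_iso_typing[OF \<theta>] nat_iso_typing[OF \<theta>'] nat_iso_typing[OF eps] nat_iso_typing[OF u]
  have "mmap ?E (u x) = ?\<epsilon> x" if [simp]: "x \<in> Obj C" for x
  proof (rule left_invertible_functor_faithful[OF \<eta>])
    show "mmap H (mmap ?E (u x)) = mmap H (?\<epsilon> x)"
    proof (rule iso_mor_cancel_left[OF nat_iso_iso_mor[OF \<theta> that]])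
      have "\<theta> x \<cdot> mmap H (mmap ?E (u x)) = u x \<cdot> \<theta> (omap ?E x)"
        using naturality[OF nat_iso_trans[OF \<theta>], of "u x" "omap ?E x" x] by simp
      also have "\<dots> = \<theta> x \<cdot> mmap H (?\<epsilon> x) \<cdot> \<theta>' (omap ?E x) \<cdot> \<theta> (omap ?E x)"
        by (simp add: u_def)
      finally show "\<theta> x \<cdot> mmap H (mmap ?E (u x)) = \<theta> x \<cdot> mmap H (?\<epsilon> x)"
        by (simp add: \<theta>'\<theta>)
    qed simp_all
  qed simp_all
  with u show ?thesis
    by (rule that)
qed

end

locale unital_action = category C + group G
  for C :: "('o, 'm) cat" and G :: "('g, 'r) monoid_scheme" +
  fixes E :: "'g \<Rightarrow> ('o, 'm) func" and \<epsilon> :: "'g \<times> 'g \<Rightarrow> 'o \<Rightarrow> 'm" and u :: "'o \<Rightarrow> 'm"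
  assumes act: "(E, \<epsilon>) \<in> group_actions C G"
    and unit_iso: "nat_iso C (E \<one>\<^bsub>G\<^esub>) (id_func C) u"
    and unit: "x \<in> Obj C \<Longrightarrow> mmap (E \<one>\<^bsub>G\<^esub>) (u x) = \<epsilon> (\<one>\<^bsub>G\<^esub>, \<one>\<^bsub>G\<^esub>) x"
begin

lemma E_endo [simp]: "h \<in> carrier G \<Longrightarrow> endofunctor C (E h)"
  by (rule group_action_func(2)[OF act])

lemmas structure_iso = group_action_nat_iso[OF act]

lemma structure_typing [simp]:
  assumes "h \<in> carrier G" "k \<in> carrier G" "x \<in> Obj C"
  shows "\<epsilon> (h, k) x \<in> Mor C" "Dom C (\<epsilon> (h, k) x) = omap (E h) (omap (E k) x)"
    "Cod C (\<epsilon> (h, k) x) = omap (E (h \<otimes>\<^bsub>G\<^esub> k)) x"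
  using nat_iso_typing[OF structure_iso[OF assms(1,2)] assms(3)] assms by simp_all

lemma unit_typing [simp]:
  assumes "x \<in> Obj C"
  shows "u x \<in> Mor C" "Dom C (u x) = omap (E \<one>\<^bsub>G\<^esub>) x" "Cod C (u x) = x"
  using nat_iso_typing[OF unit_iso assms] assms by simp_all

lemma structure_natural:
  assumes "h \<in> carrier G" "k \<in> carrier G" "f \<in> Mor C"
  shows "\<epsilon> (h, k) (Cod C f) \<cdot> mmap (E h) (mmap (E k) f) = mmap (E (h \<otimes>\<^bsub>G\<^esub> k)) f \<cdot> \<epsilon> (h, k) (Dom C f)"
  using naturality[OF nat_iso_trans[OF structure_iso[OF assms(1,2)]] assms(3) refl refl] assms(3)
  by simp

text \<open>The unit laws come from the cocycle condition: at \<open>(1, 1, h)\<close> by cancelling an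
  isomorphism and using that \<open>E\<^sub>1\<close> is faithful, at \<open>(h, 1, 1)\<close> by naturality of \<open>\<epsilon>\<close> in the
  morphism \<open>u\<close>.\<close>

lemma unit_left:
  assumes [simp]: "h \<in> carrier G" "x \<in> Obj C"
  shows "\<epsilon> (\<one>\<^bsub>G\<^esub>, h) x = u (omap (E h) x)"
proof -
  obtain H \<theta> where H: "endofunctor C H" "nat_iso C (comp_func C H (E \<one>\<^bsub>G\<^esub>)) (id_func C) \<theta>"
    using group_action_func(1)[OF act one_closed] unfolding autoequivalence_def by blast
  have eq: "\<epsilon> (\<one>\<^bsub>G\<^esub>, \<one>\<^bsub>G\<^esub>) (omap (E h) x) = mmap (E \<one>\<^bsub>G\<^esub>) (\<epsilon> (\<one>\<^bsub>G\<^esub>, h) x)"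
  proof (rule iso_mor_cancel_left[OF nat_iso_iso_mor[OF structure_iso[OF one_closed assms(1)] assms(2)]])
    show "\<epsilon> (\<one>\<^bsub>G\<^esub>, h) x \<cdot> \<epsilon> (\<one>\<^bsub>G\<^esub>, \<one>\<^bsub>G\<^esub>) (omap (E h) x) =
        \<epsilon> (\<one>\<^bsub>G\<^esub>, h) x \<cdot> mmap (E \<one>\<^bsub>G\<^esub>) (\<epsilon> (\<one>\<^bsub>G\<^esub>, h) x)"
      using group_action_cocycle[OF act one_closed one_closed assms] by simp
  qed simp_all
  show ?thesis
    by (rule left_invertible_functor_faithful[OF H(2) E_endo[OF one_closed] H(1)]) (simp_all add: unit eq)
qed

lemma unit_right:
  assumes [simp]: "h \<in> carrier G" "x \<in> Obj C"
  shows "\<epsilon> (h, \<one>\<^bsub>G\<^esub>) x = mmap (E h) (u x)"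
proof (rule iso_mor_cancel_right)
  let ?y = "omap (E \<one>\<^bsub>G\<^esub>) x"
  note iso = nat_iso_iso_mor[OF structure_iso[OF assms(1) one_closed]]
  show "iso_mor C (\<epsilon> (h, \<one>\<^bsub>G\<^esub>) ?y)"
    by (rule iso) simp
  have "\<epsilon> (h, \<one>\<^bsub>G\<^esub>) ?y = mmap (E h) (mmap (E \<one>\<^bsub>G\<^esub>) (u x))"
  proof (rule iso_mor_cancel_left[OF iso[OF assms(2)]])
    show "\<epsilon> (h, \<one>\<^bsub>G\<^esub>) x \<cdot> \<epsilon> (h, \<one>\<^bsub>G\<^esub>) ?y = \<epsilon> (h, \<one>\<^bsub>G\<^esub>) x \<cdot> mmap (E h) (mmap (E \<one>\<^bsub>G\<^esub>) (u x))"
      using group_action_cocycle[OF act assms(1) one_closed one_closed assms(2)] by (simp add: unit)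
  qed simp_all
  then show "\<epsilon> (h, \<one>\<^bsub>G\<^esub>) x \<cdot> \<epsilon> (h, \<one>\<^bsub>G\<^esub>) ?y = mmap (E h) (u x) \<cdot> \<epsilon> (h, \<one>\<^bsub>G\<^esub>) ?y"
    using structure_natural[OF assms(1) one_closed, of "u x"] by simp
qed simp_all

end

section \<open>Every action of a cyclic group is induced\<close>

locale unital_cyclic_action = category_cyclic_group C G g d + unital_action C G E \<epsilon> u
  for C :: "('o, 'm) cat" and G :: "('g, 'r) monoid_scheme" and g d E \<epsilon> u +
  fixes v :: "'o \<Rightarrow> 'm"
  assumes v_iso: "nat_iso C (id_func C) (E \<one>\<^bsub>G\<^esub>) v"
    and u_v: "x \<in> Obj C \<Longrightarrow> u x \<cdot> v x = Ident C x"
    and v_u: "x \<in> Obj C \<Longrightarrow> v x \<cdot> u x = Ident C (omap (E \<one>\<^bsub>G\<^esub>) x)"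
begin

lemma v_typing [simp]:
  assumes "x \<in> Obj C"
  shows "v x \<in> Mor C" "Dom C (v x) = x" "Cod C (v x) = omap (E \<one>\<^bsub>G\<^esub>) x"
  using nat_iso_typing[OF v_iso assms] assms by simp_all

lemmas pow_simps [simp] = func_power_add_simps[OF E_endo[OF g_closed]]

text \<open>The canonical isomorphism \<open>E\<^sub>g\<^sup>n \<rightarrow> E\<^bsub>g^n\<^esub>\<close>, an iterated structure isomorphism.\<close>

primrec collect :: "nat \<Rightarrow> 'o \<Rightarrow> 'm" where
  "collect 0 = v"
| "collect (Suc n) = comp_nt C (\<epsilon> (g, g [^]\<^bsub>G\<^esub> n)) (whisker_left C (E g) (collect n))"

lemma nat_iso_collect: "nat_iso C (func_power C (E g) n) (E (g [^]\<^bsub>G\<^esub> n)) (collect n)"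
proof (induction n)
  case 0
  then show ?case
    by (simp add: v_iso)
next
  case (Suc n)
  have "nat_iso C (comp_func C (E g) (E (g [^]\<^bsub>G\<^esub> n))) (E (g [^]\<^bsub>G\<^esub> Suc n)) (\<epsilon> (g, g [^]\<^bsub>G\<^esub> n))"
    unfolding nat_pow_Suc2[OF g_closed] by (rule structure_iso) simp_all
  then show ?case
    unfolding collect.simps func_power.simps
    by (intro nat_iso_comp_nt[OF nat_iso_whisker_left[OF Suc]]) (simp_all del: nat_pow_Suc)
qed

lemmas collect_typing [simp] = nat_iso_typing[OF nat_iso_collect]

text \<open>By induction on \<open>m\<close>: the cocycle condition at \<open>(g, g\<^sup>m, g\<^sup>n)\<close> moves the factor \<open>E\<^sub>g\<close> past
  the splitting, and the base case is the left unit law. The latter is the reason for starting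
  the iteration at the inverse \<open>v\<close> of the unit isomorphism.\<close>

lemma collect_add:
  assumes [simp]: "x \<in> Obj C"
  shows "collect (m + n) x = \<epsilon> (g [^]\<^bsub>G\<^esub> m, g [^]\<^bsub>G\<^esub> n) x \<cdot>
    mmap (E (g [^]\<^bsub>G\<^esub> m)) (collect n x) \<cdot> collect m (omap (func_power C (E g) n) x)"
proof (induction m)
  case 0
  let ?y = "omap (func_power C (E g) n) x" and ?z = "omap (E (g [^]\<^bsub>G\<^esub> n)) x"
  have "u ?z \<cdot> mmap (E \<one>\<^bsub>G\<^esub>) (collect n x) \<cdot> v ?y = u ?z \<cdot> v ?z \<cdot> collect n x"
    using naturality[OF nat_iso_trans[OF v_iso], of "collect n x" ?y ?z] by simp
  also have "\<dots> = (u ?z \<cdot> v ?z) \<cdot> collect n x"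
    by simp
  finally show ?case
    by (simp add: unit_left u_v del: Comp_assoc)
next
  case (Suc m)
  let ?h = "g [^]\<^bsub>G\<^esub> m" and ?k = "g [^]\<^bsub>G\<^esub> n"
  let ?y = "omap (func_power C (E g) n) x" and ?z = "omap (E ?k) x"
  let ?f = "collect n x"
  have gm: "g \<otimes>\<^bsub>G\<^esub> ?h = g [^]\<^bsub>G\<^esub> Suc m" and hk: "?h \<otimes>\<^bsub>G\<^esub> ?k = g [^]\<^bsub>G\<^esub> (m + n)"
    by (simp_all only: nat_pow_Suc2[OF g_closed] nat_pow_mult[OF g_closed])
  note [simp del] = nat_pow_Suc
  have [simp]: "omap (E (g \<otimes>\<^bsub>G\<^esub> ?h)) w = omap (E (g [^]\<^bsub>G\<^esub> Suc m)) w"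
      "omap (E (?h \<otimes>\<^bsub>G\<^esub> ?k)) w = omap (E (g [^]\<^bsub>G\<^esub> (m + n))) w" for w
    by (simp_all only: gm hk)
  have [simp]: "omap (E (g [^]\<^bsub>G\<^esub> Suc m \<otimes>\<^bsub>G\<^esub> ?k)) w = omap (E (g \<otimes>\<^bsub>G\<^esub> g [^]\<^bsub>G\<^esub> (m + n))) w" for w
    by (simp only: gm[symmetric] hk[symmetric] m_assoc g_closed nat_pow_closed)
  have "collect (Suc m + n) x = \<epsilon> (g, g [^]\<^bsub>G\<^esub> (m + n)) x \<cdot> mmap (E g) (\<epsilon> (?h, ?k) x) \<cdot>
      mmap (E g) (mmap (E ?h) ?f) \<cdot> mmap (E g) (collect m ?y)"
    by (simp add: Suc endofunctor_Comp)
  also have "\<dots> = (\<epsilon> (g, g [^]\<^bsub>G\<^esub> (m + n)) x \<cdot> mmap (E g) (\<epsilon> (?h, ?k) x)) \<cdot>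
      mmap (E g) (mmap (E ?h) ?f) \<cdot> mmap (E g) (collect m ?y)"
    by simp
  also have "\<epsilon> (g, g [^]\<^bsub>G\<^esub> (m + n)) x \<cdot> mmap (E g) (\<epsilon> (?h, ?k) x) =
      \<epsilon> (g [^]\<^bsub>G\<^esub> Suc m, ?k) x \<cdot> \<epsilon> (g, ?h) ?z"
    using group_action_cocycle[OF act g_closed nat_pow_closed[OF g_closed] nat_pow_closed[OF g_closed] assms, of m n]
    by (simp only: gm hk)
  also have "(\<epsilon> (g [^]\<^bsub>G\<^esub> Suc m, ?k) x \<cdot> \<epsilon> (g, ?h) ?z) \<cdot>
      mmap (E g) (mmap (E ?h) ?f) \<cdot> mmap (E g) (collect m ?y) =
      \<epsilon> (g [^]\<^bsub>G\<^esub> Suc m, ?k) x \<cdot> (\<epsilon> (g, ?h) ?z \<cdot> mmap (E g) (mmap (E ?h) ?f)) \<cdot> mmap (E g) (collect m ?y)"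
    by simp
  also have "\<epsilon> (g, ?h) ?z \<cdot> mmap (E g) (mmap (E ?h) ?f) = mmap (E (g [^]\<^bsub>G\<^esub> Suc m)) ?f \<cdot> \<epsilon> (g, ?h) ?y"
    using structure_natural[OF g_closed, of ?h ?f] by (simp add: gm)
  finally show ?case
    by simp
qed

text \<open>The exponents \<open>0\<close> and \<open>d\<close> belong to the same group element, so the two maps to \<open>E\<^sub>1\<close>
  from \<open>E\<^sub>g\<^sup>d\<close> and from \<open>Id\<close> combine to the required isomorphism \<open>E\<^sub>g\<^sup>d \<rightarrow> Id\<close>.\<close>

definition generator_iso :: "'o \<Rightarrow> 'm" where
  "generator_iso = comp_nt C u (collect d)"

lemma pow_d [simp]: "g [^]\<^bsub>G\<^esub> d = \<one>\<^bsub>G\<^esub>"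
  using pow_order_eq_1[OF g_closed] order by simp

lemma nat_iso_generator_iso: "nat_iso C (func_power C (E g) d) (id_func C) generator_iso"
  unfolding generator_iso_def
  using nat_iso_collect[of d] by (intro nat_iso_comp_nt[OF _ unit_iso]) simp_all

lemma generator_iso_apply: "x \<in> Obj C \<Longrightarrow> generator_iso x = u x \<cdot> collect d x"
  by (simp add: generator_iso_def)

lemma collect_d_typing [simp]:
  assumes "x \<in> Obj C"
  shows "Cod C (collect d x) = omap (E \<one>\<^bsub>G\<^esub>) x"
  using assms by (simp add: nat_iso_typing(3)[OF nat_iso_collect])

lemma collect_one: "x \<in> Obj C \<Longrightarrow> collect (Suc 0) x = Ident C (omap (E g) x)"
  by (simp add: unit_right u_v flip: endofunctor_Comp)

text \<open>Both sides of \<open>F c = c F\<close> come from the isomorphism \<open>E\<^sub>g\<^bsup>d + 1\<^esup> \<rightarrow> E\<^sub>g\<close>, by splitting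
  the exponent as \<open>1 + d\<close> or as \<open>d + 1\<close>.\<close>

lemma generator_pair: "(E g, generator_iso) \<in> compatible_pairs C d"
proof -
  have "mmap (E g) (generator_iso x) = generator_iso (omap (E g) x)" if [simp]: "x \<in> Obj C" for x
  proof -
    have "mmap (E g) (generator_iso x) = collect (Suc d) x"
      by (simp add: generator_iso_apply unit_right endofunctor_Comp)
    also have "\<dots> = generator_iso (omap (E g) x)"
      using collect_add[of x d "Suc 0"]
      by (simp add: generator_iso_apply unit_left collect_one del: collect.simps)
    finally show ?thesis .
  qed
  then have "whisker_left C (E g) generator_iso = whisker_right C generator_iso (E g)"
    unfolding whisker_left_def whisker_right_def by (intro restrict_ext)
  then show ?thesis
    by (simp add: compatible_pairs_def nat_iso_generator_iso)
qed

sublocale generator: compatible_pair C d "E g" generator_iso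
  by (rule compatible_pairI[OF generator_pair])

text \<open>Cancelling a block of \<open>d\<close> factors by the isomorphism \<open>E\<^sub>g\<^sup>d \<rightarrow> Id\<close> does not change the
  collected map, because \<open>\<epsilon>\<close> at \<open>(g\<^sup>n, g\<^sup>d) = (g\<^sup>n, 1)\<close> is given by the right unit law.\<close>

lemma collect_reduce:
  assumes [simp]: "x \<in> Obj C"
  shows "collect n x = collect (n mod d) x \<cdot> generator.reduce n x"
proof (induction n rule: generator.add_d_induct)
  case (less n)
  then show ?case
    by (simp add: generator.reduce_less)
next
  case (step n)
  have "collect (n + d) x = mmap (E (g [^]\<^bsub>G\<^esub> n)) (generator_iso x) \<cdot> collect n (omap (generator.pow d) x)"
    by (simp add: collect_add unit_right generator_iso_apply endofunctor_Comp)
  also have "\<dots> = collect n x \<cdot> mmap (generator.pow n) (generator_iso x)"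
    by (rule naturality[OF nat_iso_trans[OF nat_iso_collect], symmetric]) simp_all
  finally show ?case
    by (simp add: step generator.reduce_step_apply pow_mod)
qed

lemma induced_action_generator_iso:
  "(induced_action C G g d (E g, generator_iso), (E, \<epsilon>)) \<in> action_iso C G"
proof -
  let ?F = "fst (induced_action C G g d (E g, generator_iso))"
    and ?\<phi> = "snd (induced_action C G g d (E g, generator_iso))"
  let ?\<delta> = "\<lambda>h. collect (exponent G g d h)"
  have "nat_iso C (?F h) (E h) (?\<delta> h)" if h: "h \<in> carrier G" for h
    using h by (elim carrierE) (simp add: nat_iso_collect)
  moreover have "comp_nt C (?\<delta> (h \<otimes>\<^bsub>G\<^esub> k)) (?\<phi> (h, k)) =
      comp_nt C (\<epsilon> (h, k)) (hcomp (E h) (?F k) (?\<delta> h) (?\<delta> k))"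
    if hk: "h \<in> carrier G" "k \<in> carrier G" for h k
  proof -
    obtain i j where ij: "i < d" "h = g [^]\<^bsub>G\<^esub> i" "j < d" "k = g [^]\<^bsub>G\<^esub> j"
      using hk by (metis carrierE)
    show ?thesis
      using ij unfolding comp_nt_def
      by (intro restrict_ext) (simp add: nat_pow_mult induced_action_structure generator_pair
          collect_add[symmetric] collect_reduce[symmetric])
  qed
  moreover have "(?F, ?\<phi>) \<in> group_actions C G"
    using induced_action_in_group_actions[OF generator_pair] by simp
  ultimately have "((?F, ?\<phi>), (E, \<epsilon>)) \<in> action_iso C G"
    unfolding action_iso_iff using act by (intro conjI exI[of _ ?\<delta>] ballI)
  then show ?thesis
    by simp
qed

end

lemma (in category_cyclic_group) action_iso_induced_action:
  assumes "A \<in> group_actions C G"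
  obtains p where "p \<in> compatible_pairs C d" "(induced_action C G g d p, A) \<in> action_iso C G"
proof -
  obtain E \<epsilon> where A: "A = (E, \<epsilon>)" and act: "(E, \<epsilon>) \<in> group_actions C G"
    using assms by (cases A) auto
  obtain u where u: "nat_iso C (E \<one>\<^bsub>G\<^esub>) (id_func C) u"
      "\<And>x. x \<in> Obj C \<Longrightarrow> mmap (E \<one>\<^bsub>G\<^esub>) (u x) = \<epsilon> (\<one>\<^bsub>G\<^esub>, \<one>\<^bsub>G\<^esub>) x"
    using group_action_unit[OF group_axioms act] by metis
  obtain v where v: "nat_iso C (id_func C) (E \<one>\<^bsub>G\<^esub>) v"
      "\<And>x. x \<in> Obj C \<Longrightarrow> v x \<cdot> u x = Ident C (omap (E \<one>\<^bsub>G\<^esub>) x)"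
      "\<And>x. x \<in> Obj C \<Longrightarrow> u x \<cdot> v x = Ident C (omap (id_func C) x)"
    using nat_iso_inverse[OF u(1)] group_action_func(2)[OF act] by auto
  interpret unital_cyclic_action C G g d E \<epsilon> u v
    using act u v by unfold_locales auto
  show ?thesis
    using that[OF generator_pair] induced_action_generator_iso A by blast
qed

section \<open>The bijection of isomorphism classes\<close>

text \<open>A relation pulled back along \<open>f\<close> from an equivalence relation identifies exactly the
  elements whose images are equivalent; so \<open>f\<close> is injective on classes.\<close>

lemma bij_betw_quotient_of_pullback:
  assumes S: "equiv B S"
    and f: "\<And>a. a \<in> A \<Longrightarrow> f a \<in> B"
    and R: "R = {(a, a'). a \<in> A \<and> a' \<in> A \<and> (f a, f a') \<in> S}"
    and surj: "\<And>b. b \<in> B \<Longrightarrow> \<exists>a \<in> A. (f a, b) \<in> S"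
  shows "\<exists>\<Phi>. bij_betw \<Phi> (A // R) (B // S) \<and> (\<forall>a \<in> A. \<Phi> (R `` {a}) = S `` {f a})"
proof -
  define \<Phi> where "\<Phi> X = S `` (f ` X)" for X
  have \<Phi>: "\<Phi> (R `` {a}) = S `` {f a}" if "a \<in> A" for a
    using S f[OF that] that unfolding \<Phi>_def R
    by (auto elim!: equivE dest: refl_onD transD symD)
  have class_eq: "R `` {a} = R `` {a'}" if "a \<in> A" "a' \<in> A" "S `` {f a} = S `` {f a'}" for a a'
  proof -
    have "(f a, f a') \<in> S"
      using eq_equiv_class[OF that(3) S] f that(2) by simp
    then show ?thesis
      using S that unfolding R by (auto elim!: equivE dest: transD symD)
  qed
  have "inj_on \<Phi> (A // R)"
  proof (rule inj_onI)
    fix X Y assume "X \<in> A // R" "Y \<in> A // R" and eq: "\<Phi> X = \<Phi> Y"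
    then obtain a a' where "a \<in> A" "X = R `` {a}" "a' \<in> A" "Y = R `` {a'}"
      by (elim quotientE)
    then show "X = Y"
      using eq class_eq[of a a'] by (simp add: \<Phi>)
  qed
  moreover have "\<Phi> ` (A // R) = B // S"
  proof
    show "\<Phi> ` (A // R) \<subseteq> B // S"
      by (auto elim!: quotientE simp: \<Phi> f quotientI)
    show "B // S \<subseteq> \<Phi> ` (A // R)"
    proof
      fix X assume "X \<in> B // S"
      then obtain b where b: "b \<in> B" "X = S `` {b}"
        by (rule quotientE)
      then obtain a where a: "a \<in> A" "(f a, b) \<in> S"
        using surj by blast
      have "\<Phi> (R `` {a}) = X"
        using \<Phi>[OF a(1)] equiv_class_eq[OF S a(2)] b by simp
      then show "X \<in> \<Phi> ` (A // R)"
        using quotientI[OF a(1)] by blast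
    qed
  qed
  ultimately show ?thesis
    using \<Phi> by (auto simp: bij_betw_def)
qed

theorem proposition3p4:
  fixes C :: "('o, 'm) cat"
    and G :: "('g, 'r) monoid_scheme"
    and g :: 'g
    and d :: nat
  assumes "category C"
    and "d \<ge> 2"
    and "group G"
    and "order G = d"
    and "g \<in> carrier G"
    and "carrier G = {g [^]\<^bsub>G\<^esub> i | i :: nat. i < d}"
  shows "\<exists>\<Phi>. bij_betw \<Phi> (compatible_pairs C d // pair_iso C d)
                        (group_actions C G // action_iso C G) \<and>
    (\<forall>p \<in> compatible_pairs C d.
      \<Phi> (pair_iso C d `` {p}) = action_iso C G `` {induced_action C G g d p})"
proof -
  interpret category C by fact
  interpret group G by fact
  interpret category_cyclic_group C G g d
    using assms by unfold_locales
  have "pair_iso C d = {(p, q). p \<in> compatible_pairs C d \<and> q \<in> compatible_pairs C d \<and>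
      (induced_action C G g d p, induced_action C G g d q) \<in> action_iso C G}"
    (is "_ = ?R")
  proof (intro equalityI subrelI)
    fix p q assume "(p, q) \<in> pair_iso C d"
    moreover from this have "p \<in> compatible_pairs C d" "q \<in> compatible_pairs C d"
      by (auto simp: pair_iso_def)
    ultimately show "(p, q) \<in> ?R"
      using induced_action_iso_of_pair_iso by (cases p, cases q) simp
  next
    fix p q assume "(p, q) \<in> ?R"
    then show "(p, q) \<in> pair_iso C d"
      using pair_iso_of_induced_action_iso by (cases p, cases q) simp
  qed
  then show ?thesis
  proof (rule bij_betw_quotient_of_pullback[OF equiv_action_iso[OF group_axioms], rotated])
    show "induced_action C G g d p \<in> group_actions C G" if "p \<in> compatible_pairs C d" for p
      using induced_action_in_group_actions that by (cases p) auto
    show "\<exists>p \<in> compatible_pairs C d. (induced_action C G g d p, A) \<in> action_iso C G"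
      if "A \<in> group_actions C G" for A
      using action_iso_induced_action[OF that] by blast
  qed
qed

end
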